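(* Let $n_A,n_B\ge 0$ be integers, $\mathcal{H}_A=(\mathbb{C}^2)^{\otimes n_A}$, $\mathcal{H}_B=(\mathbb{C}^2)^{\otimes n_B}$, and let $\mathcal{H}_E$ be a Hilbert space. For every unitary $U$ acting on $\mathcal{H}_A\otimes\mathcal{H}_B$ and for every $\varepsilon>0$, given sufficiently many EPR pairs shared between Alice and Bob, there exists a nonlocal operation $\mathcal{AB}$ for Alice and Bob, consisting of local operations and one round of mutual communication, such that for any initial state $|\psi\rangle\in\mathcal{H}_A\otimes\mathcal{H}_B\otimes\mathcal{H}_E$ of the tripartite system $ABE$ (with Alice holding $A$ and Bob holding $B$), the joint execution of $\mathcal{AB}$ transforms $|\psi\rangle$ into $|\varphi\rangle=(U\otimes\mathbb{I})|\psi\rangle$, except with probability $\varepsilon$.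
   Context: An EPR pair is the two-qubit state $(|0\rangle|0\rangle+|1\rangle|1\rangle)/\sqrt2$, one qubit held by Alice and the other by Bob; finitely many are used, and their number and the operation $\mathcal{AB}$ may depend on $U$ and $\varepsilon$ but not on $|\psi\rangle$. Local operations of Alice act on $A$ and her halves of the EPR pairs (and ancillas); those of Bob act on $B$ and his halves. One round of mutual communication means that Alice and Bob simultaneously exchange one classical message each: each message is computed before the other party's message is received, and after the exchange each may again act locally. $\mathbb{I}$ is the identity on $\mathcal{H}_E$. At the end Alice holds the $n_A$-qubit register $A$ and Bob the $n_B$-qubit register $B$ of $|\varphi\rangle$. *)

theory Defs
  imports Complex_Main "Jordan_Normal_Form.Schur_Decomposition"
begin

section \<open>Complex Hilbert spaces\<close>

text \<open>The inner product is conjugate-linear in its first argument. Positive definiteness is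
  contained in the last axiom.\<close>

class complex_hilbert_space = banach +
  fixes scaleC :: "complex \<Rightarrow> 'a \<Rightarrow> 'a"  (infixr \<open>*\<^sub>C\<close> 75)
    and cinner :: "'a \<Rightarrow> 'a \<Rightarrow> complex"
  assumes scaleC_of_real: "complex_of_real r *\<^sub>C x = r *\<^sub>R x"
    and scaleC_add_right: "c *\<^sub>C (x + y) = c *\<^sub>C x + c *\<^sub>C y"
    and scaleC_add_left: "(c + d) *\<^sub>C x = c *\<^sub>C x + d *\<^sub>C x"
    and scaleC_scaleC: "c *\<^sub>C (d *\<^sub>C x) = (c * d) *\<^sub>C x"
    and cinner_commute: "cinner x y = cnj (cinner y x)"
    and cinner_add_left: "cinner (x + y) z = cinner x z + cinner y z"
    and cinner_scaleC_left: "cinner (c *\<^sub>C x) y = cnj c * cinner x y"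
    and cinner_self: "cinner x x = complex_of_real ((norm x)\<^sup>2)"

instantiation complex :: complex_hilbert_space
begin

definition scaleC_complex :: "complex \<Rightarrow> complex \<Rightarrow> complex"
  where "scaleC_complex c x = c * x"

definition cinner_complex :: "complex \<Rightarrow> complex \<Rightarrow> complex"
  where "cinner_complex x y = cnj x * y"

instance
proof
  fix r :: real and c d x y z :: complex
  show "complex_of_real r *\<^sub>C x = r *\<^sub>R x"
    by (simp add: scaleC_complex_def scaleR_conv_of_real)
  show "c *\<^sub>C (x + y) = c *\<^sub>C x + c *\<^sub>C y"
    by (simp add: scaleC_complex_def distrib_left)
  show "(c + d) *\<^sub>C x = c *\<^sub>C x + d *\<^sub>C x"
    by (simp add: scaleC_complex_def distrib_right)
  show "c *\<^sub>C (d *\<^sub>C x) = (c * d) *\<^sub>C x"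
    by (simp add: scaleC_complex_def)
  show "cinner x y = cnj (cinner y x)"
    by (simp add: cinner_complex_def)
  show "cinner (x + y) z = cinner x z + cinner y z"
    by (simp add: cinner_complex_def distrib_right)
  show "cinner (c *\<^sub>C x) y = cnj c * cinner x y"
    by (simp add: cinner_complex_def scaleC_complex_def)
  show "cinner x x = complex_of_real ((norm x)\<^sup>2)"
    using complex_norm_square[of x] by (simp add: cinner_complex_def mult.commute)
qed

end


section \<open>States of a tripartite system and operators on them\<close>

text \<open>If Alice's and Bob's systems have dimensions \<open>dA\<close> and \<open>dB\<close>, the vector
  \<open>\<Sum>a<dA. \<Sum>b<dB. |a\<rangle> \<otimes> |b\<rangle> \<otimes> \<psi> a b\<close> of \<open>\<complex>^dA \<otimes> \<complex>^dB \<otimes> H\<^sub>E\<close> is represented by its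
  \<open>H\<^sub>E\<close>-valued coefficient function \<open>\<psi>\<close>; values outside the range \<open>a < dA\<close>, \<open>b < dB\<close> are irrelevant.
  Basis vectors of \<open>n\<close> qubits are numbered by \<open>0, \<dots>, 2 ^ n - 1\<close>, and a pair of basis indices
  \<open>i\<close>, \<open>j\<close> of a tensor product of spaces of dimensions \<open>p\<close>, \<open>q\<close> is numbered \<open>i * q + j\<close>.\<close>

type_synonym 'e state = "nat \<Rightarrow> nat \<Rightarrow> 'e"

definition norm_sq :: "nat \<Rightarrow> nat \<Rightarrow> 'e::complex_hilbert_space state \<Rightarrow> real" where
  "norm_sq dA dB \<psi> = (\<Sum>a<dA. \<Sum>b<dB. (norm (\<psi> a b))\<^sup>2)"

definition apply_A :: "complex mat \<Rightarrow> 'e::complex_hilbert_space state \<Rightarrow> 'e state" where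
  "apply_A K \<psi> = (\<lambda>a b. \<Sum>k<dim_col K. (K $$ (a, k)) *\<^sub>C \<psi> k b)"

definition apply_B :: "complex mat \<Rightarrow> 'e::complex_hilbert_space state \<Rightarrow> 'e state" where
  "apply_B L \<psi> = (\<lambda>a b. \<Sum>k<dim_col L. (L $$ (b, k)) *\<^sub>C \<psi> a k)"

definition apply_AB :: "nat \<Rightarrow> nat \<Rightarrow> complex mat \<Rightarrow> 'e::complex_hilbert_space state \<Rightarrow> 'e state" where
  "apply_AB dA dB U \<psi> =
     (\<lambda>a b. \<Sum>a'<dA. \<Sum>b'<dB. (U $$ (a * dB + b, a' * dB + b')) *\<^sub>C \<psi> a' b')"

definition unitary_mat :: "nat \<Rightarrow> complex mat \<Rightarrow> bool" where
  "unitary_mat d U \<longleftrightarrow>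
     U \<in> carrier_mat d d \<and> mat_adjoint U * U = 1\<^sub>m d \<and> U * mat_adjoint U = 1\<^sub>m d"

definition epr :: "nat \<Rightarrow> nat \<Rightarrow> complex" where
  "epr x y = (if x = y then complex_of_real (1 / sqrt 2) else 0)"

text \<open>One more EPR pair: Alice's half becomes the last tensor factor of her system, Bob's half
  the last tensor factor of his.\<close>

definition add_epr :: "'e::complex_hilbert_space state \<Rightarrow> 'e state" where
  "add_epr \<psi> = (\<lambda>a b. epr (a mod 2) (b mod 2) *\<^sub>C \<psi> (a div 2) (b div 2))"


section \<open>Local operations and one round of mutual communication\<close>

text \<open>A local operation from a \<open>d\<close>-dimensional to a \<open>d'\<close>-dimensional system, given by its Kraus
  operators. The position in the list is the classical outcome; ancillas, unitaries, measurements
  and discarding of subsystems are all of this form.\<close>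

definition local_operation :: "nat \<Rightarrow> nat \<Rightarrow> complex mat list \<Rightarrow> bool" where
  "local_operation d d' Ks \<longleftrightarrow>
     set Ks \<subseteq> carrier_mat d' d \<and>
     (\<forall>i<d. \<forall>j<d. (\<Sum>K\<leftarrow>Ks. (mat_adjoint K * K) $$ (i, j)) = (1\<^sub>m d) $$ (i, j))"

text \<open>The strategy of one party. After the operation \<open>before\<close> with outcome \<open>i\<close>, the
  party sends the message \<open>msg i\<close>; having received the message \<open>y\<close> of the other party, it
  performs the operation \<open>after i y\<close>.\<close>

record strategy =
  before :: "complex mat list"
  msg :: "nat \<Rightarrow> nat"
  after :: "nat \<Rightarrow> nat \<Rightarrow> complex mat list"

text \<open>The party starts with \<open>n\<close> qubits and its halves of \<open>m\<close> EPR pairs, and ends with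
  \<open>n\<close> qubits; in between its system may have any finite dimension.\<close>

definition valid_strategy :: "nat \<Rightarrow> nat \<Rightarrow> strategy \<Rightarrow> bool" where
  "valid_strategy n m S \<longleftrightarrow>
     (\<exists>d. local_operation (2 ^ n * 2 ^ m) d (before S) \<and>
          (\<forall>i<length (before S). \<forall>y. local_operation d (2 ^ n) (after S i y)))"

text \<open>Outcomes \<open>(i, j, k, l)\<close> of a joint execution: \<open>i\<close>, \<open>k\<close> are the outcomes of Alice's first
  and second operation, \<open>j\<close>, \<open>l\<close> those of Bob's.\<close>

definition outcomes :: "strategy \<Rightarrow> strategy \<Rightarrow> (nat \<times> nat \<times> nat \<times> nat) set" where
  "outcomes A B =
     {(i, j, k, l). i < length (before A) \<and> j < length (before B) \<and>
        k < length (after A i (msg B j)) \<and> l < length (after B j (msg A i))}"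

text \<open>The unnormalized final state of \<open>ABE\<close> for given outcomes; its squared norm is the
  probability of these outcomes.\<close>

definition final_state ::
  "nat \<Rightarrow> strategy \<Rightarrow> strategy \<Rightarrow> 'e::complex_hilbert_space state \<Rightarrow> nat \<times> nat \<times> nat \<times> nat \<Rightarrow> 'e state" where
  "final_state m A B \<psi> = (\<lambda>(i, j, k, l).
     apply_B (after B j (msg A i) ! l) (apply_A (after A i (msg B j) ! k)
       (apply_B (before B ! j) (apply_A (before A ! i) ((add_epr ^^ m) \<psi>)))))"

text \<open>Equality of states up to normalization and global phase.\<close>

definition same_state ::
  "nat \<Rightarrow> nat \<Rightarrow> 'e::complex_hilbert_space state \<Rightarrow> 'e state \<Rightarrow> bool" where
  "same_state dA dB \<chi> \<phi> \<longleftrightarrow> (\<exists>c. \<forall>a<dA. \<forall>b<dB. \<chi> a b = c *\<^sub>C \<phi> a b)"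

text \<open>The probability that the final state of \<open>ABE\<close> is not \<open>\<phi>\<close>.\<close>

definition failure_prob ::
  "nat \<Rightarrow> nat \<Rightarrow> nat \<Rightarrow> strategy \<Rightarrow> strategy \<Rightarrow>
    'e::complex_hilbert_space state \<Rightarrow> 'e state \<Rightarrow> real" where
  "failure_prob nA nB m A B \<psi> \<phi> =
     (\<Sum>\<omega> \<in> {\<omega> \<in> outcomes A B. \<not> same_state (2 ^ nA) (2 ^ nB) (final_state m A B \<psi> \<omega>) \<phi>}.
        norm_sq (2 ^ nA) (2 ^ nB) (final_state m A B \<psi> \<omega>))"

end

theory Submission
  imports Defs
begin

text \<open>
  The protocol is exact whenever it succeeds. Alice teleports \<open>A\<close> to Bob without telling him her
  outcome, so Bob holds a register of dimension \<open>d = dA * dB\<close> to which some unitary \<open>X x y\<close> still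
  has to be applied, where \<open>x\<close> is known to Alice only and \<open>y\<close> to Bob only. There is one pair of
  teleportation channels for every possible value of \<open>y\<close>. Bob teleports the register to Alice through channel \<open>y\<close>,
  with outcome \<open>q\<close>; in every channel \<open>y'\<close> Alice applies \<open>X x y'\<close> and teleports the result back, with
  outcome \<open>r y'\<close>. If \<open>q = 0\<close>, which has probability \<open>1 / d\<^sup>2\<close>, the register now holds the desired
  state up to the correction \<open>r y\<close>. Otherwise the unitary that remains to be applied again depends
  on Alice's data \<open>(x, r)\<close> and Bob's data \<open>(y, q)\<close>, and the step is repeated. All corrections are product
  unitaries, so a register that is right up to a local unitary stays so in later steps. After \<open>n\<close> steps Bob
  teleports the \<open>A\<close> part back to Alice. Nothing has been communicated so far; a single exchange of
  all outcomes lets both parties apply their local corrections. The failure probability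
  is at most \<open>(1 - 1 / d\<^sup>2) ^ n\<close>.
\<close>

section \<open>Matrices and unitary error bases\<close>

text \<open>The obstacle is the order of operations: a teleportation error \<open>\<sigma> q\<close>
  strikes before \<open>X x y\<close> is applied, so the register ends with
  \<open>\<sigma> r * X x y * \<sigma> q\<close>, and \<open>\<sigma> q\<close> cannot in general be
  moved to the left as a local correction. Undoing it requires a new nonlocal unitary, determined by
  \<open>(x, r)\<close> once the label \<open>(y, q)\<close> is given, and Bob then has
  \<open>d\<^sup>2\<close> times as many labels. Hence the recursion has to treat all numbers of
  labels at once. The proof works with coefficients of joint operators instead of states. On success
  the joint operator is a scalar times a local unitary times the target, so the probability is the
  squared modulus of the scalar, up to normalization, for every initial state alike. The space
  \<open>H\<^sub>E\<close> enters only when the coefficients are turned into strategies. Both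
  dimensions are powers of 2, so every entangled state that occurs consists of EPR pairs.\<close>

lemma mult_add_less_mult:
  fixes a b p q :: nat
  assumes "a < p" "b < q"
  shows "a * q + b < p * q"
proof -
  have "a * q + b < Suc a * q" using assms by simp
  also have "\<dots> \<le> p * q" using assms by (intro mult_right_mono) auto
  finally show ?thesis .
qed

lemma less_mult_div_mod:
  fixes i p q :: nat
  assumes "i < p * q"
  shows "i div q < p" "i mod q < q"
proof -
  show "i div q < p" using assms by (simp add: less_mult_imp_div_less)
  show "i mod q < q" using assms by (cases q) auto
qed

lemma mult_add_div_mod:
  fixes a b q :: nat
  assumes "b < q"
  shows "(a * q + b) div q = a" "(a * q + b) mod q = b"
  using assms by simp_all

lemma sum_lessThan_mult:
  fixes f :: "nat \<Rightarrow> 'a::comm_monoid_add"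
  shows "(\<Sum>i<p * q. f i) = (\<Sum>a<p. \<Sum>b<q. f (a * q + b))"
proof -
  have "(\<Sum>i<p * q. f i) = (\<Sum>a<p. sum f {a * q..<a * q + q})"
    by (simp add: sum.nat_group)
  also have "\<dots> = (\<Sum>a<p. \<Sum>b<q. f (a * q + b))"
  proof (rule sum.cong[OF refl])
    fix a
    show "sum f {a * q..<a * q + q} = (\<Sum>b<q. f (a * q + b))"
      using sum.shift_bounds_nat_ivl[of f 0 "a * q" q]
      by (simp add: add.commute atLeast0LessThan)
  qed
  finally show ?thesis .
qed

section \<open>Adjoints and unitary matrices\<close>

lemma dim_mat_adjoint [simp]:
  "dim_row (mat_adjoint A) = dim_col A" "dim_col (mat_adjoint A) = dim_row A"
  by (auto simp: mat_adjoint_def mat_of_rows_def)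

lemma mat_adjoint_index [simp]:
  fixes A :: "complex mat"
  assumes "i < dim_col A" "j < dim_row A"
  shows "mat_adjoint A $$ (i, j) = cnj (A $$ (j, i))"
  using assms by (simp add: mat_adjoint_def mat_of_rows_def cols_def)

lemma mat_mult_index_sum:
  assumes "i < dim_row A" "j < dim_col B" "dim_col A = n" "dim_row B = n"
  shows "(A * B) $$ (i, j) = (\<Sum>k<n. A $$ (i, k) * B $$ (k, j))"
  using assms by (simp add: scalar_prod_def atLeast0LessThan)

lemma mat_adjoint_mult:
  fixes A B :: "complex mat"
  assumes "dim_col A = dim_row B"
  shows "mat_adjoint (A * B) = mat_adjoint B * mat_adjoint A"
proof (rule eq_matI)
  fix i j assume "i < dim_row (mat_adjoint B * mat_adjoint A)" "j < dim_col (mat_adjoint B * mat_adjoint A)"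
  then show "mat_adjoint (A * B) $$ (i, j) = (mat_adjoint B * mat_adjoint A) $$ (i, j)"
    using assms by (simp add: mat_mult_index_sum del: index_mult_mat(1)) (simp add: mult.commute)
qed auto

lemma mat_adjoint_adjoint [simp]: "mat_adjoint (mat_adjoint A) = (A :: complex mat)"
  by (rule eq_matI) auto

lemma mat_adjoint_one [simp]: "mat_adjoint (1\<^sub>m n) = (1\<^sub>m n :: complex mat)"
  by (rule eq_matI) auto

lemma unitary_carrier: "unitary_mat n U \<Longrightarrow> U \<in> carrier_mat n n"
  by (simp add: unitary_mat_def)

lemma unitary_one: "unitary_mat n (1\<^sub>m n)"
  by (simp add: unitary_mat_def)

lemma unitary_adjoint: "unitary_mat n U \<Longrightarrow> unitary_mat n (mat_adjoint U)"
  by (auto simp: unitary_mat_def)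

lemma unitary_mult:
  assumes "unitary_mat n U" "unitary_mat n V"
  shows "unitary_mat n (U * V)"
proof -
  note U = assms(1)[unfolded unitary_mat_def] and V = assms(2)[unfolded unitary_mat_def]
  have c: "U \<in> carrier_mat n n" "V \<in> carrier_mat n n"
    "mat_adjoint U \<in> carrier_mat n n" "mat_adjoint V \<in> carrier_mat n n"
    using U V by auto
  have adj: "mat_adjoint (U * V) = mat_adjoint V * mat_adjoint U"
    using c by (intro mat_adjoint_mult) auto
  have "mat_adjoint (U * V) * (U * V) = mat_adjoint V * (mat_adjoint U * U) * V"
    unfolding adj using c by (simp add: assoc_mult_mat[of _ n n _ n _ n])
  also have "\<dots> = 1\<^sub>m n" using U V c by simp
  finally have 1: "mat_adjoint (U * V) * (U * V) = 1\<^sub>m n" .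
  have "(U * V) * mat_adjoint (U * V) = U * (V * mat_adjoint V) * mat_adjoint U"
    unfolding adj using c by (simp add: assoc_mult_mat[of _ n n _ n _ n])
  also have "\<dots> = 1\<^sub>m n" using U V c by simp
  finally show ?thesis using 1 c unfolding unitary_mat_def by auto
qed

lemma unitary_columns:
  assumes "unitary_mat n U" "j < n" "k < n"
  shows "(\<Sum>i<n. cnj (U $$ (i, j)) * U $$ (i, k)) = (if j = k then 1 else 0)"
proof -
  have U: "U \<in> carrier_mat n n" "mat_adjoint U * U = 1\<^sub>m n" using assms by (auto simp: unitary_mat_def)
  have "(\<Sum>i<n. cnj (U $$ (i, j)) * U $$ (i, k)) = (mat_adjoint U * U) $$ (j, k)"
    using assms U(1) by (subst mat_mult_index_sum[where n = n]) auto
  then show ?thesis using U assms by auto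
qed

text \<open>Only the left inverse has to be computed, since a left inverse of a square matrix over a
  field is two-sided.\<close>

lemma unitary_matI:
  assumes U: "U \<in> carrier_mat n n"
    and col: "\<And>j k. j < n \<Longrightarrow> k < n \<Longrightarrow>
      (\<Sum>i<n. cnj (U $$ (i, j)) * U $$ (i, k)) = (if j = k then 1 else 0)"
  shows "unitary_mat n U"
proof -
  have adj: "mat_adjoint U \<in> carrier_mat n n" using U by auto
  have left: "mat_adjoint U * U = 1\<^sub>m n"
  proof (rule eq_matI)
    fix i j assume "i < dim_row (1\<^sub>m n :: complex mat)" "j < dim_col (1\<^sub>m n :: complex mat)"
    then show "(mat_adjoint U * U) $$ (i, j) = 1\<^sub>m n $$ (i, j)"
      using U col[of i j] by (subst mat_mult_index_sum[where n = n]) auto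
  qed (use U in auto)
  then show ?thesis
    using U mat_mult_left_right_inverse[OF adj U left] by (simp add: unitary_mat_def)
qed

lemma unitary_cancel:
  assumes "unitary_mat n U" "A \<in> carrier_mat m n"
  shows "A * mat_adjoint U * U = A" "A * U * mat_adjoint U = A"
proof -
  have U: "U \<in> carrier_mat n n" "mat_adjoint U \<in> carrier_mat n n"
    "mat_adjoint U * U = 1\<^sub>m n" "U * mat_adjoint U = 1\<^sub>m n"
    using assms by (auto simp: unitary_mat_def)
  show "A * mat_adjoint U * U = A" "A * U * mat_adjoint U = A"
    using assms(2) U by (simp_all add: assoc_mult_mat[of _ m n _ n _ n])
qed

section \<open>Kronecker products and local unitaries\<close>

definition kron :: "complex mat \<Rightarrow> complex mat \<Rightarrow> complex mat" where
  "kron A B = mat (dim_row A * dim_row B) (dim_col A * dim_col B)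
     (\<lambda>(i, j). A $$ (i div dim_row B, j div dim_col B) * B $$ (i mod dim_row B, j mod dim_col B))"

lemma dim_kron [simp]:
  "dim_row (kron A B) = dim_row A * dim_row B" "dim_col (kron A B) = dim_col A * dim_col B"
  by (simp_all add: kron_def)

lemma kron_carrier [simp]:
  "A \<in> carrier_mat p q \<Longrightarrow> B \<in> carrier_mat r s \<Longrightarrow> kron A B \<in> carrier_mat (p * r) (q * s)"
  by auto

lemma kron_index:
  assumes "i < dim_row A * dim_row B" "j < dim_col A * dim_col B"
  shows "kron A B $$ (i, j) =
    A $$ (i div dim_row B, j div dim_col B) * B $$ (i mod dim_row B, j mod dim_col B)"
  using assms by (simp add: kron_def)

lemma kron_index_pair:
  assumes "i < dim_row A" "j < dim_col A" "k < dim_row B" "l < dim_col B"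
  shows "kron A B $$ (i * dim_row B + k, j * dim_col B + l) = A $$ (i, j) * B $$ (k, l)"
  using assms by (simp add: kron_def mult_add_less_mult)

lemma kron_mult:
  assumes "dim_col A = dim_row C" "dim_col B = dim_row D"
  shows "kron A B * kron C D = kron (A * C) (B * D)"
proof (rule eq_matI)
  fix i j assume ij: "i < dim_row (kron (A * C) (B * D))" "j < dim_col (kron (A * C) (B * D))"
  then have b: "i div dim_row B < dim_row A" "i mod dim_row B < dim_row B"
    "j div dim_col D < dim_col C" "j mod dim_col D < dim_col D"
    by (auto dest: less_mult_div_mod)
  let ?p = "dim_row C" and ?q = "dim_row D"
  have "(kron A B * kron C D) $$ (i, j) =
      (\<Sum>m<?p. \<Sum>n<?q. kron A B $$ (i, m * ?q + n) * kron C D $$ (m * ?q + n, j))"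
    using ij assms by (subst mat_mult_index_sum[where n = "?p * ?q"]) (auto simp: sum_lessThan_mult)
  also have "\<dots> = (\<Sum>m<?p. \<Sum>n<?q. (A $$ (i div dim_row B, m) * C $$ (m, j div dim_col D)) *
      (B $$ (i mod dim_row B, n) * D $$ (n, j mod dim_col D)))"
  proof (intro sum.cong refl)
    fix m n assume "m \<in> {..<?p}" "n \<in> {..<?q}"
    then have "kron A B $$ (i, m * ?q + n) = A $$ (i div dim_row B, m) * B $$ (i mod dim_row B, n)"
      "kron C D $$ (m * ?q + n, j) = C $$ (m, j div dim_col D) * D $$ (n, j mod dim_col D)"
      using ij assms by (auto simp: kron_def mult_add_less_mult)
    then show "kron A B $$ (i, m * ?q + n) * kron C D $$ (m * ?q + n, j) =
      (A $$ (i div dim_row B, m) * C $$ (m, j div dim_col D)) *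
      (B $$ (i mod dim_row B, n) * D $$ (n, j mod dim_col D))" by simp
  qed
  also have "\<dots> = (\<Sum>m<?p. A $$ (i div dim_row B, m) * C $$ (m, j div dim_col D)) *
      (\<Sum>n<?q. B $$ (i mod dim_row B, n) * D $$ (n, j mod dim_col D))"
    by (simp add: sum_product)
  also have "\<dots> = kron (A * C) (B * D) $$ (i, j)"
    using ij b assms by (simp add: kron_index mat_mult_index_sum del: index_mult_mat(1))
  finally show "(kron A B * kron C D) $$ (i, j) = kron (A * C) (B * D) $$ (i, j)" .
qed (use assms in auto)

lemma kron_adjoint: "mat_adjoint (kron A B) = kron (mat_adjoint A) (mat_adjoint B)"
proof (rule eq_matI)
  fix i j assume "i < dim_row (kron (mat_adjoint A) (mat_adjoint B))"
    "j < dim_col (kron (mat_adjoint A) (mat_adjoint B))"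
  then show "mat_adjoint (kron A B) $$ (i, j) = kron (mat_adjoint A) (mat_adjoint B) $$ (i, j)"
    by (simp add: kron_index less_mult_div_mod)
qed auto

lemma kron_one: "kron (1\<^sub>m p) (1\<^sub>m q) = 1\<^sub>m (p * q)"
proof (rule eq_matI)
  fix i j assume "i < dim_row (1\<^sub>m (p * q) :: complex mat)" "j < dim_col (1\<^sub>m (p * q) :: complex mat)"
  then have ij: "i < p * q" "j < p * q" by auto
  have "i = j \<longleftrightarrow> i div q = j div q \<and> i mod q = j mod q"
    by (metis div_mult_mod_eq)
  then show "kron (1\<^sub>m p) (1\<^sub>m q) $$ (i, j) = 1\<^sub>m (p * q) $$ (i, j)"
    using ij less_mult_div_mod[OF ij(1)] less_mult_div_mod[OF ij(2)] by (auto simp: kron_index)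
qed auto

lemma unitary_kron:
  assumes "unitary_mat p A" "unitary_mat q B"
  shows "unitary_mat (p * q) (kron A B)"
proof -
  note A = assms(1)[unfolded unitary_mat_def] and B = assms(2)[unfolded unitary_mat_def]
  have d: "dim_row A = p" "dim_col A = p" "dim_row B = q" "dim_col B = q" using A B by auto
  have "mat_adjoint (kron A B) * kron A B = 1\<^sub>m (p * q)"
    "kron A B * mat_adjoint (kron A B) = 1\<^sub>m (p * q)"
    unfolding kron_adjoint using A B d by (simp_all only: kron_mult dim_mat_adjoint kron_one)
  then show ?thesis using A B unfolding unitary_mat_def by simp
qed

text \<open>These are the corrections that the parties can undo separately once all outcomes are
  known. Closure under products and adjoints is what lets a success persist.\<close>

definition local_unitary :: "nat \<Rightarrow> nat \<Rightarrow> complex mat \<Rightarrow> bool" where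
  "local_unitary dA dB W \<longleftrightarrow> (\<exists>A B. unitary_mat dA A \<and> unitary_mat dB B \<and> W = kron A B)"

lemma local_unitary_unitary: "local_unitary dA dB W \<Longrightarrow> unitary_mat (dA * dB) W"
  by (auto simp: local_unitary_def unitary_kron)

lemma local_unitary_mult:
  assumes "local_unitary dA dB V" "local_unitary dA dB W"
  shows "local_unitary dA dB (V * W)"
proof -
  obtain A B C D where *: "unitary_mat dA A" "unitary_mat dB B" "V = kron A B"
    "unitary_mat dA C" "unitary_mat dB D" "W = kron C D"
    using assms by (auto simp: local_unitary_def)
  have "V * W = kron (A * C) (B * D)"
    using *(3,6) unitary_carrier[OF *(1)] unitary_carrier[OF *(2)] unitary_carrier[OF *(4)]
      unitary_carrier[OF *(5)] by (simp add: kron_mult)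
  then show ?thesis using * unitary_mult unfolding local_unitary_def by blast
qed

lemma local_unitary_adjoint:
  "local_unitary dA dB W \<Longrightarrow> local_unitary dA dB (mat_adjoint W)"
  unfolding local_unitary_def by (metis kron_adjoint unitary_adjoint)

text \<open>The summation condition is a completeness relation: divided by \<open>sqrt n\<close>,
  the \<open>n\<^sup>2\<close> matrices form an orthonormal basis for the Hilbert-Schmidt inner
  product. They thus describe a generalized Bell measurement, and \<open>\<sigma> 0\<close> is its
  error-free outcome.\<close>

definition error_basis :: "nat \<Rightarrow> (nat \<Rightarrow> complex mat) \<Rightarrow> bool" where
  "error_basis n \<sigma> \<longleftrightarrow> \<sigma> 0 = 1\<^sub>m n \<and> (\<forall>q<n\<^sup>2. unitary_mat n (\<sigma> q)) \<and>
     (\<forall>i<n. \<forall>j<n. \<forall>k<n. \<forall>l<n. (\<Sum>q<n\<^sup>2. cnj (\<sigma> q $$ (i, j)) * \<sigma> q $$ (k, l)) =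
       (if i = k \<and> j = l then of_nat n else 0))"

lemma error_basis_one: "error_basis n \<sigma> \<Longrightarrow> \<sigma> 0 = 1\<^sub>m n"
  by (simp add: error_basis_def)

lemma error_basis_unitary: "error_basis n \<sigma> \<Longrightarrow> q < n\<^sup>2 \<Longrightarrow> unitary_mat n (\<sigma> q)"
  by (simp add: error_basis_def)

lemma error_basis_sum:
  assumes "error_basis n \<sigma>" "i < n" "j < n" "k < n" "l < n"
  shows "(\<Sum>q<n\<^sup>2. cnj (\<sigma> q $$ (i, j)) * \<sigma> q $$ (k, l)) = (if i = k \<and> j = l then of_nat n else 0)"
  using assms unfolding error_basis_def by blast

text \<open>Right multiplication by a unitary preserves the Hilbert-Schmidt inner product, so
  completeness survives. This lets Alice merge the application of \<open>X\<close> with her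
  teleportation measurement.\<close>

lemma error_basis_sum_mult:
  assumes \<sigma>: "error_basis n \<sigma>" and X: "unitary_mat n X" and "i < n" "j < n" "k < n" "l < n"
  shows "(\<Sum>q<n\<^sup>2. cnj ((\<sigma> q * X) $$ (i, j)) * (\<sigma> q * X) $$ (k, l)) =
    (if i = k \<and> j = l then of_nat n else 0)"
proof -
  have "(\<Sum>q<n\<^sup>2. cnj ((\<sigma> q * X) $$ (i, j)) * (\<sigma> q * X) $$ (k, l)) =
      (\<Sum>q<n\<^sup>2. \<Sum>r<n. \<Sum>s<n. (cnj (X $$ (r, j)) * X $$ (s, l)) *
        (cnj (\<sigma> q $$ (i, r)) * \<sigma> q $$ (k, s)))"
  proof (intro sum.cong refl)
    fix q assume "q \<in> {..<n\<^sup>2}"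
    then have c: "\<sigma> q \<in> carrier_mat n n" "X \<in> carrier_mat n n"
      using error_basis_unitary[OF \<sigma>] X unitary_carrier by auto
    then have "(\<sigma> q * X) $$ (i, j) = (\<Sum>r<n. \<sigma> q $$ (i, r) * X $$ (r, j))"
      "(\<sigma> q * X) $$ (k, l) = (\<Sum>s<n. \<sigma> q $$ (k, s) * X $$ (s, l))"
      using assms by (simp_all add: mat_mult_index_sum[where n = n] del: index_mult_mat(1))
    then show "cnj ((\<sigma> q * X) $$ (i, j)) * (\<sigma> q * X) $$ (k, l) =
        (\<Sum>r<n. \<Sum>s<n. (cnj (X $$ (r, j)) * X $$ (s, l)) * (cnj (\<sigma> q $$ (i, r)) * \<sigma> q $$ (k, s)))"
      by (simp only: cnj_sum complex_cnj_mult sum_product) (simp only: mult_ac)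
  qed
  also have "\<dots> = (\<Sum>r<n. \<Sum>s<n. (cnj (X $$ (r, j)) * X $$ (s, l)) *
        (\<Sum>q<n\<^sup>2. cnj (\<sigma> q $$ (i, r)) * \<sigma> q $$ (k, s)))"
    unfolding sum_distrib_left by (rule trans[OF sum.swap], rule sum.cong[OF refl], rule sum.swap)
  also have "\<dots> = (\<Sum>r<n. \<Sum>s<n. (cnj (X $$ (r, j)) * X $$ (s, l)) *
        (if i = k \<and> r = s then of_nat n else 0))"
    using assms by (intro sum.cong refl) (simp add: error_basis_sum[OF \<sigma>])
  also have "\<dots> = (\<Sum>r<n. if i = k then of_nat n * (cnj (X $$ (r, j)) * X $$ (r, l)) else 0)"
    by (intro sum.cong refl) (auto simp: if_distrib mult_ac cong: if_cong)
  also have "\<dots> = (if i = k then of_nat n * (\<Sum>r<n. cnj (X $$ (r, j)) * X $$ (r, l)) else 0)"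
    by (simp add: sum_distrib_left)
  also have "\<dots> = (if i = k \<and> j = l then of_nat n else 0)"
    using assms by (simp add: unitary_columns[OF X])
  finally show ?thesis .
qed

text \<open>Orthogonality of the characters of the cyclic group: for distinct \<open>i\<close> and
  \<open>k\<close> the sum is a geometric series whose ratio is a nontrivial \<open>n\<close>-th
  root of unity.\<close>

lemma sum_powers_root_of_unity:
  fixes i k :: nat
  assumes "i < n" "k < n"
  shows "(\<Sum>s<n. cnj (cis (2 * pi / n) ^ (s * i)) * cis (2 * pi / n) ^ (s * k)) =
    (if i = k then of_nat n else 0)"
proof -
  define z where "z = cnj (cis (2 * pi / n)) ^ i * cis (2 * pi / n) ^ k"
  have z_cis: "z = cis (2 * pi * (real k - real i) / n)"
    by (simp add: z_def cis_cnj Complex.DeMoivre cis_mult diff_divide_distrib algebra_simps)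
  have summand: "cnj (cis (2 * pi / n) ^ (s * i)) * cis (2 * pi / n) ^ (s * k) = z ^ s" for s
    unfolding z_def power_mult_distrib complex_cnj_power
    by (simp add: power_mult[symmetric] mult.commute)
  show ?thesis
  proof (cases "i = k")
    case True
    then have "z = 1" by (simp add: z_cis)
    then show ?thesis unfolding summand using True by simp
  next
    case False
    have n: "n > 0" using assms by simp
    have "z \<noteq> 1"
    proof
      assume "z = 1"
      then have "cos (2 * pi * (real k - real i) / n) = 1"
        unfolding z_cis by (metis cis.sel(1) one_complex.sel(1))
      then obtain m :: int where "2 * pi * (real k - real i) / n = m * 2 * pi"
        by (auto simp: cos_one_2pi_int)
      then have "2 * pi * (real k - real i) = 2 * pi * (m * n)"
        using n by (simp add: field_simps)
      then have "real k - real i = m * n" by simp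
      then have eq: "int k - int i = m * int n"
        by (metis of_int_diff of_int_eq_iff of_int_mult of_int_of_nat_eq)
      then have "m \<noteq> 0" using False by auto
      then have "\<bar>m\<bar> * int n \<ge> 1 * int n" by (intro mult_right_mono) auto
      moreover have "\<bar>m\<bar> * int n = \<bar>int k - int i\<bar>" using eq by (simp add: abs_mult)
      ultimately show False using assms by auto
    qed
    moreover have "z ^ n = 1"
    proof -
      have "z ^ n = cis (2 * pi * (real_of_int (int k - int i)))"
        using n by (simp add: z_cis Complex.DeMoivre)
      also have "\<dots> = 1" by (rule cis_multiple_2pi) auto
      finally show ?thesis .
    qed
    ultimately have "(\<Sum>s<n. z ^ s) = 0" by (simp add: geometric_sum)
    then show ?thesis unfolding summand using False by simp
  qed
qed

text \<open>Both sides say that \<open>t\<close> is \<open>j - i\<close> modulo \<open>n\<close>;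
  the summand \<open>n\<close> guards against truncated subtraction.\<close>

lemma eq_shift_mod_iff:
  fixes i j t n :: nat
  assumes "i < n" "j < n" "t < n"
  shows "j = (i + t) mod n \<longleftrightarrow> t = (j + n - i) mod n"
proof -
  have "(i + t) mod n = (if i + t < n then i + t else i + t - n)"
    using assms by (simp add: le_mod_geq)
  moreover have "(j + n - i) mod n = (if j < i then j + n - i else j - i)"
    using assms by (simp add: le_mod_geq)
  ultimately show ?thesis using assms by (simp split: if_split) linarith
qed

lemma unique_shift:
  fixes i j n :: nat
  assumes "i < n" "j < n"
  shows "(\<Sum>t<n. if j = (i + t) mod n then (1::complex) else 0) = 1"
proof -
  have "(j = (i + t) mod n) = (t = (j + n - i) mod n)" if "t < n" for t
    using assms that by (rule eq_shift_mod_iff)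
  then have "(\<Sum>t<n. if j = (i + t) mod n then (1::complex) else 0) =
      (\<Sum>t<n. if t = (j + n - i) mod n then 1 else 0)"
    by (intro sum.cong) auto
  also have "\<dots> = 1" using assms by simp
  finally show ?thesis .
qed

text \<open>The Heisenberg--Weyl operators: powers of the clock matrix times powers of the cyclic shift.\<close>

lemma error_basis_exists:
  assumes n: "n > 0"
  obtains \<sigma> where "error_basis n \<sigma>"
proof -
  define \<omega> where "\<omega> = cis (2 * pi / n)"
  have \<omega>: "cnj (\<omega> ^ i) * \<omega> ^ i = 1" for i
    by (simp add: \<omega>_def Complex.DeMoivre cis_cnj cis_mult)
  \<comment> \<open>The index \<open>q = s * n + t\<close> encodes the power \<open>s\<close> of the
    clock matrix and the shift \<open>t\<close>; both are trivial for \<open>q = 0\<close>.\<close>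
  define \<sigma> where "\<sigma> = (\<lambda>q. mat n n (\<lambda>(i, j). if j = (i + q mod n) mod n then \<omega> ^ (q div n * i) else 0))"
  have one: "\<sigma> 0 = 1\<^sub>m n" unfolding \<sigma>_def by (rule eq_matI) auto
  have unitary: "unitary_mat n (\<sigma> q)" for q
  proof (rule unitary_matI)
    fix j k assume jk: "j < n" "k < n"
    let ?t = "q mod n"
    \<comment> \<open>A column has a single nonzero entry, of modulus 1; \<open>inv\<close> locates
      its row.\<close>
    have inv: "(j = (i + ?t) mod n) = (i = (j + n - ?t) mod n)" if "i < n" "j < n" for i j
      using eq_shift_mod_iff[of ?t n j i] that n by (simp add: add.commute)
    have "(\<Sum>i<n. cnj (\<sigma> q $$ (i, j)) * \<sigma> q $$ (i, k)) =
        (\<Sum>i<n. if i = (j + n - ?t) mod n then (if j = k then 1 else 0) else 0)"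
    proof (rule sum.cong[OF refl])
      fix i assume i: "i \<in> {..<n}"
      show "cnj (\<sigma> q $$ (i, j)) * \<sigma> q $$ (i, k) =
          (if i = (j + n - ?t) mod n then (if j = k then 1 else 0) else 0)"
      proof (cases "j = (i + ?t) mod n")
        case True
        then show ?thesis using i jk inv[of i j] \<omega> by (auto simp: \<sigma>_def)
      next
        case False
        then show ?thesis using i jk inv[of i j] by (simp add: \<sigma>_def)
      qed
    qed
    also have "\<dots> = (if j = k then 1 else 0)" using n by simp
    finally show "(\<Sum>i<n. cnj (\<sigma> q $$ (i, j)) * \<sigma> q $$ (i, k)) = (if j = k then 1 else 0)" .
  qed (simp add: \<sigma>_def)
  have "(\<Sum>q<n\<^sup>2. cnj (\<sigma> q $$ (i, j)) * \<sigma> q $$ (k, l)) = (if i = k \<and> j = l then of_nat n else 0)"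
    if b: "i < n" "j < n" "k < n" "l < n" for i j k l
  proof -
    \<comment> \<open>The sum over clock powers forces \<open>i = k\<close>; then \<open>j\<close>
      and \<open>l\<close> must agree, and exactly one shift takes \<open>i\<close> to
      \<open>j\<close>.\<close>
    have "(\<Sum>q<n\<^sup>2. cnj (\<sigma> q $$ (i, j)) * \<sigma> q $$ (k, l)) =
        (\<Sum>s<n. \<Sum>t<n. (if j = (i + t) mod n \<and> l = (k + t) mod n then 1 else 0) *
          (cnj (\<omega> ^ (s * i)) * \<omega> ^ (s * k)))"
      unfolding power2_eq_square sum_lessThan_mult
      using b by (intro sum.cong refl) (auto simp: \<sigma>_def)
    also have "\<dots> = (\<Sum>t<n. (if j = (i + t) mod n \<and> l = (k + t) mod n then 1 else 0) *
        (if i = k then of_nat n else 0))"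
      by (subst sum.swap)
        (simp only: sum_distrib_left[symmetric] \<omega>_def sum_powers_root_of_unity[OF b(1,3)])
    also have "\<dots> = (if i = k \<and> j = l then of_nat n else 0) *
        (\<Sum>t<n. if j = (i + t) mod n then 1 else 0)"
      unfolding sum_distrib_left by (intro sum.cong refl) auto
    also have "\<dots> = (if i = k \<and> j = l then of_nat n else 0)"
      using b by (simp add: unique_shift)
    finally show ?thesis .
  qed
  then show ?thesis using that[of \<sigma>] one unitary unfolding error_basis_def by blast
qed

text \<open>Completeness factorizes over the two digits of \<open>q\<close>. The point of the
  product form is that every teleportation error on the joint register is then a local
  unitary.\<close>

lemma error_basis_kron:
  assumes \<sigma>: "error_basis p \<sigma>" and \<tau>: "error_basis r \<tau>"
  shows "error_basis (p * r) (\<lambda>q. kron (\<sigma> (q div r\<^sup>2)) (\<tau> (q mod r\<^sup>2)))" (is "error_basis _ ?\<rho>")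
proof -
  have u: "unitary_mat p (\<sigma> (q div r\<^sup>2))" "unitary_mat r (\<tau> (q mod r\<^sup>2))"
    if "q < (p * r)\<^sup>2" for q
  proof -
    have "q < p\<^sup>2 * r\<^sup>2" using that by (simp add: power_mult_distrib)
    then show "unitary_mat p (\<sigma> (q div r\<^sup>2))" "unitary_mat r (\<tau> (q mod r\<^sup>2))"
      using error_basis_unitary[OF \<sigma>] error_basis_unitary[OF \<tau>] less_mult_div_mod by auto
  qed
  have "?\<rho> 0 = 1\<^sub>m (p * r)"
    using error_basis_one[OF \<sigma>] error_basis_one[OF \<tau>] by (simp add: kron_one)
  moreover have "\<forall>q<(p * r)\<^sup>2. unitary_mat (p * r) (?\<rho> q)"
    using u by (simp add: unitary_kron)
  moreover have "(\<Sum>q<(p * r)\<^sup>2. cnj (?\<rho> q $$ (i, j)) * ?\<rho> q $$ (k, l)) =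
      (if i = k \<and> j = l then of_nat (p * r) else 0)"
    if b: "i < p * r" "j < p * r" "k < p * r" "l < p * r" for i j k l
  proof -
    note d = less_mult_div_mod[OF b(1)] less_mult_div_mod[OF b(2)]
      less_mult_div_mod[OF b(3)] less_mult_div_mod[OF b(4)]
    have "(\<Sum>q<(p * r)\<^sup>2. cnj (?\<rho> q $$ (i, j)) * ?\<rho> q $$ (k, l)) =
        (\<Sum>s<p\<^sup>2. \<Sum>t<r\<^sup>2. (cnj (\<sigma> s $$ (i div r, j div r)) * \<sigma> s $$ (k div r, l div r)) *
          (cnj (\<tau> t $$ (i mod r, j mod r)) * \<tau> t $$ (k mod r, l mod r)))"
      unfolding power_mult_distrib sum_lessThan_mult
    proof (intro sum.cong refl)
      fix s t assume "s \<in> {..<p\<^sup>2}" "t \<in> {..<r\<^sup>2}"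
      then have "\<sigma> s \<in> carrier_mat p p" "\<tau> t \<in> carrier_mat r r" "(s * r\<^sup>2 + t) div r\<^sup>2 = s"
          "(s * r\<^sup>2 + t) mod r\<^sup>2 = t"
        using error_basis_unitary[OF \<sigma>] error_basis_unitary[OF \<tau>] unitary_carrier
        by (auto simp: mult_add_div_mod)
      then show "cnj (?\<rho> (s * r\<^sup>2 + t) $$ (i, j)) * ?\<rho> (s * r\<^sup>2 + t) $$ (k, l) =
          (cnj (\<sigma> s $$ (i div r, j div r)) * \<sigma> s $$ (k div r, l div r)) *
          (cnj (\<tau> t $$ (i mod r, j mod r)) * \<tau> t $$ (k mod r, l mod r))"
        using b by (simp add: kron_index)
    qed
    also have "\<dots> = (\<Sum>s<p\<^sup>2. cnj (\<sigma> s $$ (i div r, j div r)) * \<sigma> s $$ (k div r, l div r)) *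
        (\<Sum>t<r\<^sup>2. cnj (\<tau> t $$ (i mod r, j mod r)) * \<tau> t $$ (k mod r, l mod r))"
      by (simp add: sum_product)
    also have "\<dots> = (if i div r = k div r \<and> j div r = l div r then of_nat p else 0) *
        (if i mod r = k mod r \<and> j mod r = l mod r then of_nat r else 0)"
      using d by (simp add: error_basis_sum[OF \<sigma>] error_basis_sum[OF \<tau>])
    also have "\<dots> = (if i = k \<and> j = l then of_nat (p * r) else 0)"
    proof -
      have "(i = k) = (i div r = k div r \<and> i mod r = k mod r)"
        "(j = l) = (j div r = l div r \<and> j mod r = l mod r)" by (metis div_mult_mod_eq)+
      then show ?thesis by auto
    qed
    finally show ?thesis .
  qed
  ultimately show ?thesis unfolding error_basis_def by blast
qed

section \<open>Kraus families and teleportation schemes\<close>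

text \<open>\<open>K i r c\<close> is the \<open>(r, c)\<close> entry of the Kraus operator for the outcome \<open>i\<close>; input
  bases are arbitrary sets so that registers and EPR halves can be kept apart as tuples.\<close>

definition kraus :: "'i set \<Rightarrow> nat set \<Rightarrow> 'c set \<Rightarrow> ('i \<Rightarrow> nat \<Rightarrow> 'c \<Rightarrow> complex) \<Rightarrow> bool" where
  "kraus I R C K \<longleftrightarrow> (\<forall>c\<in>C. \<forall>c'\<in>C.
     (\<Sum>i\<in>I. \<Sum>r\<in>R. cnj (K i r c) * K i r c') = (if c = c' then 1 else 0))"

lemma krausD:
  "kraus I R C K \<Longrightarrow> c \<in> C \<Longrightarrow> c' \<in> C \<Longrightarrow>
    (\<Sum>i\<in>I. \<Sum>r\<in>R. cnj (K i r c) * K i r c') = (if c = c' then 1 else 0)"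
  unfolding kraus_def by blast

lemma kraus_reindex:
  assumes "kraus I R C K" and f: "bij_betw f I' I" and g: "bij_betw g C' C"
  shows "kraus I' R C' (\<lambda>i r c. K (f i) r (g c))"
  unfolding kraus_def
proof (intro ballI)
  fix c c' assume c: "c \<in> C'" "c' \<in> C'"
  have "(\<Sum>i\<in>I'. \<Sum>r\<in>R. cnj (K (f i) r (g c)) * K (f i) r (g c')) =
      (\<Sum>i\<in>I. \<Sum>r\<in>R. cnj (K i r (g c)) * K i r (g c'))"
    by (rule sum.reindex_bij_betw[OF f])
  also have "\<dots> = (if g c = g c' then 1 else 0)"
    using assms(1) c bij_betwE[OF g] by (intro krausD) auto
  also have "\<dots> = (if c = c' then 1 else 0)"
    using bij_betw_imp_inj_on[OF g] c by (simp add: inj_on_eq_iff)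
  finally show "(\<Sum>i\<in>I'. \<Sum>r\<in>R. cnj (K (f i) r (g c)) * K (f i) r (g c')) = (if c = c' then 1 else 0)" .
qed

text \<open>\<open>M i j\<close> is the joint operator for the outcomes \<open>i\<close>, \<open>j\<close>. The coefficient \<open>c i j\<close> may be set to
  \<open>0\<close> for unsuccessful outcomes, and \<open>w\<close> bounds the total weight of the others.\<close>

definition succeeds ::
  "nat \<Rightarrow> nat \<Rightarrow> 'i set \<Rightarrow> 'j set \<Rightarrow> ('i \<Rightarrow> 'j \<Rightarrow> nat \<Rightarrow> nat \<Rightarrow> nat \<Rightarrow> complex) \<Rightarrow> complex mat \<Rightarrow> real \<Rightarrow> bool"
  where "succeeds dA dB I J M V w \<longleftrightarrow> (\<exists>c :: 'i \<Rightarrow> 'j \<Rightarrow> complex.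
     (\<forall>i\<in>I. \<forall>j\<in>J. c i j \<noteq> 0 \<longrightarrow> (\<exists>W. local_unitary dA dB W \<and>
        (\<forall>a<dA. \<forall>b<dB. \<forall>\<delta><dA * dB. M i j a b \<delta> = c i j * (W * V) $$ (a * dB + b, \<delta>)))) \<and>
     w \<le> (\<Sum>i\<in>I. \<Sum>j\<in>J. (cmod (c i j))\<^sup>2))"

lemma succeeds_reindex:
  assumes "succeeds dA dB I J M V w" and f: "bij_betw f I' I" and g: "bij_betw g J' J"
    and M: "\<And>i j a b \<delta>. i \<in> I' \<Longrightarrow> j \<in> J' \<Longrightarrow> a < dA \<Longrightarrow> b < dB \<Longrightarrow> \<delta> < dA * dB \<Longrightarrow>
      M' i j a b \<delta> = M (f i) (g j) a b \<delta>"
  shows "succeeds dA dB I' J' M' V w"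
proof -
  obtain c where c: "\<And>i j. i \<in> I \<Longrightarrow> j \<in> J \<Longrightarrow> c i j \<noteq> 0 \<Longrightarrow> \<exists>W. local_unitary dA dB W \<and>
        (\<forall>a<dA. \<forall>b<dB. \<forall>\<delta><dA * dB. M i j a b \<delta> = c i j * (W * V) $$ (a * dB + b, \<delta>))"
      and w: "w \<le> (\<Sum>i\<in>I. \<Sum>j\<in>J. (cmod (c i j))\<^sup>2)"
    using assms(1) unfolding succeeds_def by blast
  have "(\<Sum>i\<in>I'. \<Sum>j\<in>J'. (cmod (c (f i) (g j)))\<^sup>2) = (\<Sum>i\<in>I'. \<Sum>j\<in>J. (cmod (c (f i) j))\<^sup>2)"
    by (intro sum.cong refl sum.reindex_bij_betw[OF g])
  also have "\<dots> = (\<Sum>i\<in>I. \<Sum>j\<in>J. (cmod (c i j))\<^sup>2)"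
    by (rule sum.reindex_bij_betw[OF f])
  finally have "w \<le> (\<Sum>i\<in>I'. \<Sum>j\<in>J'. (cmod (c (f i) (g j)))\<^sup>2)" using w by simp
  moreover have "\<exists>W. local_unitary dA dB W \<and>
        (\<forall>a<dA. \<forall>b<dB. \<forall>\<delta><dA * dB. M' i j a b \<delta> = c (f i) (g j) * (W * V) $$ (a * dB + b, \<delta>))"
    if "i \<in> I'" "j \<in> J'" "c (f i) (g j) \<noteq> 0" for i j
    using c[of "f i" "g j"] that bij_betwE[OF f] bij_betwE[OF g] M by fastforce
  ultimately show ?thesis unfolding succeeds_def
    by (intro exI[of _ "\<lambda>i j. c (f i) (g j)"]) blast
qed

lemma succeeds_mono:
  assumes "succeeds dA dB I J M V w" "w' \<le> w"
  shows "succeeds dA dB I J M V w'"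
  using assms unfolding succeeds_def by (elim exE conjE) (intro exI conjI, assumption, rule order_trans)

text \<open>Alice knows the list \<open>x\<close> of unitaries, Bob knows the label \<open>y < k\<close>, and \<open>x y\<close> is to be applied to
  Bob's register. The shared maximally entangled state on \<open>E\<close> is left without its normalization
  \<open>1 / sqrt (card E)\<close>, whence the factor \<open>card E\<close> in the weight. That local unitaries succeed with
  certainty is what makes an early success survive the remaining steps.\<close>

definition scheme ::
  "nat \<Rightarrow> nat \<Rightarrow> nat \<Rightarrow> 'e set \<Rightarrow> 'i set \<Rightarrow> 'j set \<Rightarrow>
    ((nat \<Rightarrow> complex mat) \<Rightarrow> 'i \<Rightarrow> nat \<Rightarrow> 'e \<Rightarrow> complex) \<Rightarrow>
    (nat \<Rightarrow> 'j \<Rightarrow> nat \<Rightarrow> nat \<times> 'e \<Rightarrow> complex) \<Rightarrow> real \<Rightarrow> bool" where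
  "scheme dA dB k E I J K L p \<longleftrightarrow>
     finite E \<and> finite I \<and> finite J \<and> (\<exists>s. card E = 2 ^ s) \<and>
     (\<forall>y<k. kraus J {..<dB} ({..<dA * dB} \<times> E) (L y)) \<and>
     (\<forall>x. (\<forall>y<k. unitary_mat (dA * dB) (x y)) \<longrightarrow>
       kraus I {..<dA} E (K x) \<and>
       (\<forall>y<k. succeeds dA dB I J (\<lambda>i j a b \<delta>. \<Sum>e\<in>E. K x i a e * L y j b (\<delta>, e)) (x y)
         (real (card E) * (if local_unitary dA dB (x y) then 1 else p))))"

lemma schemeD:
  assumes "scheme dA dB k E I J K L p" "\<And>y. y < k \<Longrightarrow> unitary_mat (dA * dB) (x y)"
  shows "kraus I {..<dA} E (K x)"
    and "y < k \<Longrightarrow> succeeds dA dB I J (\<lambda>i j a b \<delta>. \<Sum>e\<in>E. K x i a e * L y j b (\<delta>, e)) (x y)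
      (real (card E) * (if local_unitary dA dB (x y) then 1 else p))"
  using assms unfolding scheme_def by blast+

text \<open>A step puts functions and tuples into the index sets and so changes their types.
  Relabelling by naturals restores fixed types, which the induction over the number of steps
  needs.\<close>

lemma scheme_nat:
  assumes "scheme dA dB k (E :: 'e set) (I :: 'i set) (J :: 'j set) K L p"
  shows "\<exists>(E' :: nat set) (I' :: nat set) (J' :: nat set) K' L'. scheme dA dB k E' I' J' K' L' p"
proof -
  have fin: "finite E" "finite I" "finite J" and s: "\<exists>s. card E = 2 ^ s"
    using assms unfolding scheme_def by auto
  obtain e f g where bij: "bij_betw e {..<card E} E" "bij_betw f {..<card I} I" "bij_betw g {..<card J} J"
    using fin ex_bij_betw_nat_finite by (metis atLeast0LessThan)
  have pair: "bij_betw (\<lambda>(d, z). (d, e z)) ({..<dA * dB} \<times> {..<card E}) ({..<dA * dB} \<times> E)"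
    using bij(1) unfolding bij_betw_def inj_on_def by (auto simp: image_iff) blast
  have "scheme dA dB k {..<card E} {..<card I} {..<card J} (\<lambda>x i a z. K x (f i) a (e z))
      (\<lambda>y j b (d, z). L y (g j) b (d, e z)) p"
    unfolding scheme_def
  proof (intro conjI allI impI)
    fix y assume "y < k"
    then have "kraus J {..<dB} ({..<dA * dB} \<times> E) (L y)" using assms unfolding scheme_def by blast
    from kraus_reindex[OF this bij(3) pair]
    show "kraus {..<card J} {..<dB} ({..<dA * dB} \<times> {..<card E}) (\<lambda>j b (d, z). L y (g j) b (d, e z))"
      by (simp add: case_prod_unfold)
  next
    fix x assume "\<forall>y<k. unitary_mat (dA * dB) (x y)"
    then have *: "kraus I {..<dA} E (K x)"
      "\<And>y. y < k \<Longrightarrow> succeeds dA dB I J (\<lambda>i j a b \<delta>. \<Sum>e\<in>E. K x i a e * L y j b (\<delta>, e)) (x y)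
         (real (card E) * (if local_unitary dA dB (x y) then 1 else p))"
      using assms unfolding scheme_def by blast+
    show "kraus {..<card I} {..<dA} {..<card E} (\<lambda>i a z. K x (f i) a (e z))"
      by (rule kraus_reindex[OF *(1) bij(2) bij(1)])
    fix y assume "y < k"
    have sum: "(\<Sum>z<card E. K x (f i) a (e z) * L y (g j) b (\<delta>, e z)) =
        (\<Sum>e\<in>E. K x (f i) a e * L y (g j) b (\<delta>, e))" for i j a b \<delta>
      by (rule sum.reindex_bij_betw[OF bij(1)])
    show "succeeds dA dB {..<card I} {..<card J}
        (\<lambda>i j a b \<delta>. \<Sum>z<card E. K x (f i) a (e z) * (case (\<delta>, z) of (d, z) \<Rightarrow> L y (g j) b (d, e z))) (x y)
        (real (card {..<card E}) * (if local_unitary dA dB (x y) then 1 else p))"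
      unfolding card_lessThan
      by (rule succeeds_reindex[OF *(2)[OF \<open>y < k\<close>] bij(2) bij(3)]) (simp add: sum)
  qed (use s in auto)
  then show ?thesis by blast
qed

text \<open>The condition selects a fibre along which only the value at \<open>y\<close> varies. In
  the application \<open>g\<close> is Bob's outcome, which fixes the basis state of every channel
  but \<open>y\<close>.\<close>

lemma sum_PiE_fun_upd:
  fixes \<Phi> :: "('a \<Rightarrow> 'b) \<Rightarrow> 'c::comm_monoid_add"
  assumes "finite Y" "finite S" and y: "y \<in> Y" and z: "z \<in> S" and g: "g \<in> PiE Y (\<lambda>_. S)"
  shows "(\<Sum>f\<in>PiE Y (\<lambda>_. S). if g = f(y := z) then \<Phi> f else 0) =
    (if g y = z then \<Sum>s\<in>S. \<Phi> (g(y := s)) else 0)"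
proof (cases "g y = z")
  case True
  have "{f \<in> PiE Y (\<lambda>_. S). g = f(y := z)} = (\<lambda>s. g(y := s)) ` S"
  proof (intro equalityI subsetI)
    fix f assume "f \<in> {f \<in> PiE Y (\<lambda>_. S). g = f(y := z)}"
    then have "f = g(y := f y)" "f y \<in> S" using y by auto
    then show "f \<in> (\<lambda>s. g(y := s)) ` S" by blast
  next
    fix f assume "f \<in> (\<lambda>s. g(y := s)) ` S"
    then obtain s where s: "s \<in> S" "f = g(y := s)" by blast
    then have "f \<in> PiE Y (\<lambda>_. S)" using g y by (auto simp: PiE_iff extensional_def)
    then show "f \<in> {f \<in> PiE Y (\<lambda>_. S). g = f(y := z)}" using s True by auto
  qed
  moreover have "inj_on (\<lambda>s. g(y := s)) S" by (auto simp: inj_on_def dest: fun_upd_eqD)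
  moreover have "finite (PiE Y (\<lambda>_. S))" using assms by (intro finite_PiE) auto
  ultimately show ?thesis using True by (simp add: sum.inter_filter[symmetric] sum.reindex)
next
  case False
  then have "g \<noteq> f(y := z)" for f by auto
  then show ?thesis using False by simp
qed

section \<open>Recursive construction of schemes: the base case\<close>

locale error_bases =
  fixes nA nB dA dB :: nat and \<tau> \<sigma> :: "nat \<Rightarrow> complex mat"
  assumes dims: "dA = 2 ^ nA" "dB = 2 ^ nB"
    and \<tau>: "error_basis dA \<tau>"
    and \<sigma>: "error_basis (dA * dB) \<sigma>"
    and \<sigma>_local: "q < (dA * dB)\<^sup>2 \<Longrightarrow> local_unitary dA dB (\<sigma> q)"
begin

lemma dims_pos: "dA > 0" "dB > 0"
  by (simp_all add: dims)

text \<open>No unitary is applied: Bob teleports the \<open>A\<close> factor back by measuring it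
  together with his half \<open>e\<close> in the basis given by \<open>\<tau>\<close>, and Alice
  does nothing. This suffices for a unitary that is local already; nothing is claimed for others,
  whence \<open>p = 0\<close>. The \<open>dA\<^sup>2\<close> outcomes have weight
  \<open>1 / dA\<close> each, in total the cardinality of the entangled basis.\<close>

lemma scheme_base:
  "scheme dA dB k {..<dA} {0::nat} {..<dA\<^sup>2} (\<lambda>x i a e. if a = e then 1 else 0)
     (\<lambda>y q b (\<delta>, e). if b = \<delta> mod dB then \<tau> q $$ (e, \<delta> div dB) / sqrt dA else 0) 0"
  (is "scheme _ _ _ _ _ _ ?K ?L 0")
  unfolding scheme_def
proof (intro conjI allI impI)
  fix y
  show "kraus {..<dA\<^sup>2} {..<dB} ({..<dA * dB} \<times> {..<dA}) (?L y)"
    unfolding kraus_def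
  proof (intro ballI)
    fix z z' assume z: "z \<in> {..<dA * dB} \<times> {..<dA}" "z' \<in> {..<dA * dB} \<times> {..<dA}"
    obtain \<delta> e \<delta>' e' where zs: "z = (\<delta>, e)" "z' = (\<delta>', e')" by (metis surj_pair)
    then have *: "\<delta> < dA * dB" "e < dA" "\<delta>' < dA * dB" "e' < dA" using z by auto
    note d = less_mult_div_mod[OF *(1)] less_mult_div_mod[OF *(3)]
    have "(\<Sum>q<dA\<^sup>2. \<Sum>b<dB. cnj (?L y q b (\<delta>, e)) * ?L y q b (\<delta>', e')) =
        (\<Sum>q<dA\<^sup>2. \<Sum>b<dB. if b = \<delta> mod dB then (if \<delta> mod dB = \<delta>' mod dB then
          cnj (\<tau> q $$ (e, \<delta> div dB)) * \<tau> q $$ (e', \<delta>' div dB) / dA else 0) else 0)"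
      by (intro sum.cong refl) (auto simp flip: of_real_mult)
    also have "\<dots> = (if \<delta> mod dB = \<delta>' mod dB then
        (\<Sum>q<dA\<^sup>2. cnj (\<tau> q $$ (e, \<delta> div dB)) * \<tau> q $$ (e', \<delta>' div dB)) / dA else 0)"
      using d by (simp add: sum_divide_distrib)
    also have "\<dots> = (if \<delta> mod dB = \<delta>' mod dB \<and> e = e' \<and> \<delta> div dB = \<delta>' div dB then 1 else 0)"
      using d * dims_pos by (simp add: error_basis_sum[OF \<tau>])
    also have "\<dots> = (if (\<delta>, e) = (\<delta>', e') then 1 else 0)"
      by (metis div_mult_mod_eq prod.inject)
    finally show "(\<Sum>q<dA\<^sup>2. \<Sum>b<dB. cnj (?L y q b z) * ?L y q b z') = (if z = z' then 1 else 0)"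
      unfolding zs .
  qed
next
  fix x :: "nat \<Rightarrow> complex mat"
  assume x: "\<forall>y<k. unitary_mat (dA * dB) (x y)"
  show "kraus {0} {..<dA} {..<dA} (?K x)"
    unfolding kraus_def by (auto simp: if_distrib cong: if_cong)
  fix y assume y: "y < k"
  show "succeeds dA dB {0} {..<dA\<^sup>2} (\<lambda>i j a b \<delta>. \<Sum>e<dA. ?K x i a e * ?L y j b (\<delta>, e)) (x y)
      (real (card {..<dA}) * (if local_unitary dA dB (x y) then 1 else 0))"
    unfolding succeeds_def
  proof (intro exI[of _ "\<lambda>i j. if local_unitary dA dB (x y) then complex_of_real (1 / sqrt dA) else 0"]
      conjI ballI impI)
    fix i j assume j: "j \<in> {..<dA\<^sup>2}"
      and "(if local_unitary dA dB (x y) then complex_of_real (1 / sqrt dA) else 0) \<noteq> 0"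
    then have loc: "local_unitary dA dB (x y)" by (auto split: if_splits)
    \<comment> \<open>The joint operator is \<open>kron (\<tau> j) (1\<^sub>m dB) / sqrt dA\<close>
      whatever \<open>x y\<close> is. Writing it as a multiple of \<open>W * x y\<close> forces this
      \<open>W\<close>, which is local because \<open>x y\<close> is.\<close>
    define W where "W = kron (\<tau> j) (1\<^sub>m dB) * mat_adjoint (x y)"
    have \<tau>j: "unitary_mat dA (\<tau> j)" using error_basis_unitary[OF \<tau>] j by simp
    then have kl: "local_unitary dA dB (kron (\<tau> j) (1\<^sub>m dB))"
      using unitary_one unfolding local_unitary_def by blast
    then have "local_unitary dA dB W"
      unfolding W_def by (intro local_unitary_mult local_unitary_adjoint loc)
    moreover have Wx: "W * x y = kron (\<tau> j) (1\<^sub>m dB)"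
      unfolding W_def using unitary_cancel(1) x y unitary_carrier[OF local_unitary_unitary[OF kl]] by blast
    have delta: "(\<Sum>e<dA. ?K x i a e * G e) = G a" if "a < dA" for a and G :: "nat \<Rightarrow> complex"
    proof -
      have "(\<Sum>e<dA. ?K x i a e * G e) = (\<Sum>e<dA. if a = e then G e else 0)"
        by (intro sum.cong) auto
      then show ?thesis using that by simp
    qed
    have "(\<Sum>e<dA. ?K x i a e * ?L y j b (\<delta>, e)) =
        (if local_unitary dA dB (x y) then complex_of_real (1 / sqrt dA) else 0) *
          (W * x y) $$ (a * dB + b, \<delta>)" if "a < dA" "b < dB" "\<delta> < dA * dB" for a b \<delta>
      using that loc unitary_carrier[OF \<tau>j] less_mult_div_mod[OF that(3)]
      unfolding Wx by (subst delta) (auto simp: kron_index mult_add_less_mult mult_add_div_mod)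
    ultimately show "\<exists>W. local_unitary dA dB W \<and> (\<forall>a<dA. \<forall>b<dB. \<forall>\<delta><dA * dB.
        (\<Sum>e<dA. ?K x i a e * ?L y j b (\<delta>, e)) =
          (if local_unitary dA dB (x y) then complex_of_real (1 / sqrt dA) else 0) *
          (W * x y) $$ (a * dB + b, \<delta>))" by blast
  next
    show "real (card {..<dA}) * (if local_unitary dA dB (x y) then 1 else 0)
      \<le> (\<Sum>i\<in>{0::nat}. \<Sum>j<dA\<^sup>2.
          (cmod (if local_unitary dA dB (x y) then complex_of_real (1 / sqrt dA) else 0))\<^sup>2)"
      using dims_pos by (simp add: power_divide power2_eq_square norm_divide)
  qed
qed (use dims in auto)

section \<open>One step of the recursion\<close>

abbreviation dim :: nat where "dim \<equiv> dA * dB"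

text \<open>In channel \<open>(c, \<rho>)\<close> Alice's outcome \<open>r\<close> is a projection onto the maximally entangled vector of
  \<open>\<sigma> r * X\<close>; Bob's outcome \<open>q\<close> is one onto that of \<open>\<sigma> q\<close>.\<close>

definition amp :: "complex mat \<Rightarrow> nat \<Rightarrow> nat \<times> nat \<Rightarrow> complex" where
  "amp X r = (\<lambda>(c, \<rho>). (\<sigma> r * X) $$ (\<rho>, c) / sqrt dim)"

definition bell :: "nat \<Rightarrow> nat \<Rightarrow> nat \<Rightarrow> complex" where
  "bell q \<delta> c = \<sigma> q $$ (c, \<delta>) / sqrt dim"

text \<open>Bob's new label \<open>(y, q)\<close> is encoded as \<open>z = y * dim\<^sup>2 + q\<close>. After one step his register
  carries \<open>\<sigma> (r y) * x y * \<sigma> q\<close>, which is removed here before \<open>x y\<close> is applied again.\<close>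

definition update :: "(nat \<Rightarrow> complex mat) \<Rightarrow> (nat \<Rightarrow> nat) \<Rightarrow> nat \<Rightarrow> complex mat" where
  "update x r = (\<lambda>z. x (z div dim\<^sup>2) * mat_adjoint (\<sigma> (z mod dim\<^sup>2)) * mat_adjoint (x (z div dim\<^sup>2)) *
     mat_adjoint (\<sigma> (r (z div dim\<^sup>2))))"

lemma dim_pos: "dim > 0"
  using dims_pos by simp

lemma sqrt_dim [simp]: "complex_of_real (sqrt dim) * complex_of_real (sqrt dim) = of_nat dim"
  by (simp only: of_real_mult[symmetric] real_sqrt_mult_self) simp

lemma \<sigma>_carrier: "q < dim\<^sup>2 \<Longrightarrow> \<sigma> q \<in> carrier_mat dim dim"
  using error_basis_unitary[OF \<sigma>] unitary_carrier by blast

lemma amp_complete: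
  assumes "unitary_mat dim X" and s: "s \<in> {..<dim} \<times> {..<dim}" "s' \<in> {..<dim} \<times> {..<dim}"
  shows "(\<Sum>r<dim\<^sup>2. cnj (amp X r s) * amp X r s') = (if s = s' then 1 else 0)"
proof -
  obtain c \<rho> c' \<rho>' where [simp]: "s = (c, \<rho>)" "s' = (c', \<rho>')" by (metis surj_pair)
  have "(\<Sum>r<dim\<^sup>2. cnj (amp X r s) * amp X r s') =
      (\<Sum>r<dim\<^sup>2. cnj ((\<sigma> r * X) $$ (\<rho>, c)) * (\<sigma> r * X) $$ (\<rho>', c')) / dim"
    by (simp add: amp_def sum_divide_distrib del: index_mult_mat(1) of_nat_mult)
  also have "\<dots> = (if \<rho> = \<rho>' \<and> c = c' then of_nat dim else 0) / of_nat dim"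
    using s error_basis_sum_mult[OF \<sigma> assms(1)] by auto
  finally show ?thesis using dim_pos by auto
qed

lemma amp_norm:
  assumes "unitary_mat dim X" and r: "r < dim\<^sup>2"
  shows "(\<Sum>s\<in>{..<dim} \<times> {..<dim}. (cmod (amp X r s))\<^sup>2) = 1"
proof -
  have u: "unitary_mat dim (\<sigma> r * X)" by (intro unitary_mult error_basis_unitary[OF \<sigma> r] assms(1))
  have col: "(\<Sum>\<rho><dim. (cmod ((\<sigma> r * X) $$ (\<rho>, c)))\<^sup>2) = 1" if "c < dim" for c
  proof -
    have "complex_of_real (\<Sum>\<rho><dim. (cmod ((\<sigma> r * X) $$ (\<rho>, c)))\<^sup>2) =
        (\<Sum>\<rho><dim. cnj ((\<sigma> r * X) $$ (\<rho>, c)) * (\<sigma> r * X) $$ (\<rho>, c))"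
      unfolding of_real_sum complex_norm_square by (simp only: mult.commute)
    also have "\<dots> = 1" using unitary_columns[OF u that that] by simp
    finally show ?thesis using of_real_eq_1_iff by blast
  qed
  have "(\<Sum>s\<in>{..<dim} \<times> {..<dim}. (cmod (amp X r s))\<^sup>2) =
      (\<Sum>c<dim. (\<Sum>\<rho><dim. (cmod ((\<sigma> r * X) $$ (\<rho>, c)))\<^sup>2) / dim)"
    by (simp add: sum.cartesian_product' amp_def norm_divide power_divide sum_divide_distrib
        del: index_mult_mat(1) of_nat_mult)
  also have "\<dots> = 1" using col dim_pos by simp
  finally show ?thesis .
qed

lemma bell_complete:
  assumes "\<delta> < dim" "c < dim" "\<delta>' < dim" "c' < dim"
  shows "(\<Sum>q<dim\<^sup>2. cnj (bell q \<delta> c) * bell q \<delta>' c') = (if \<delta> = \<delta>' \<and> c = c' then 1 else 0)"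
proof -
  have "(\<Sum>q<dim\<^sup>2. cnj (bell q \<delta> c) * bell q \<delta>' c') =
      (\<Sum>q<dim\<^sup>2. cnj (\<sigma> q $$ (c, \<delta>)) * \<sigma> q $$ (c', \<delta>')) / dim"
    by (simp add: bell_def sum_divide_distrib del: of_nat_mult)
  also have "\<dots> = (if c = c' \<and> \<delta> = \<delta>' then of_nat dim else 0) / of_nat dim"
    using assms error_basis_sum[OF \<sigma>] by auto
  finally show ?thesis using dim_pos by auto
qed

text \<open>Contracting the shared index \<open>c\<close> composes the two teleportations: the
  register meets \<open>\<sigma> q\<close> on the way to Alice, then \<open>X\<close>, then
  \<open>\<sigma> r\<close> on the way back. The factor \<open>1 / dim\<close> is the product of the
  two normalizations.\<close>

lemma amp_bell:
  assumes "unitary_mat dim X" "r < dim\<^sup>2" "q < dim\<^sup>2" "\<rho> < dim" "\<delta> < dim"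
  shows "(\<Sum>c<dim. amp X r (c, \<rho>) * bell q \<delta> c) = (\<sigma> r * X * \<sigma> q) $$ (\<rho>, \<delta>) / dim"
proof -
  have c: "\<sigma> r * X \<in> carrier_mat dim dim" "\<sigma> q \<in> carrier_mat dim dim"
    using \<sigma>_carrier assms unitary_carrier by (auto intro!: mult_carrier_mat)
  have "(\<Sum>c<dim. amp X r (c, \<rho>) * bell q \<delta> c) =
      (\<Sum>c<dim. (\<sigma> r * X) $$ (\<rho>, c) * \<sigma> q $$ (c, \<delta>)) / dim"
    by (simp add: amp_def bell_def sum_divide_distrib del: index_mult_mat(1) of_nat_mult)
  also have "\<dots> = (\<sigma> r * X * \<sigma> q) $$ (\<rho>, \<delta>) / dim"
    using c assms(4,5) by (subst mat_mult_index_sum[of \<rho> "\<sigma> r * X" \<delta> "\<sigma> q" dim])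
      (auto simp del: index_mult_mat(1))
  finally show ?thesis .
qed

context
  fixes x :: "nat \<Rightarrow> complex mat" and r :: "nat \<Rightarrow> nat" and y q :: nat
  assumes x: "unitary_mat dim (x y)" and r: "r y < dim\<^sup>2" and q: "q < dim\<^sup>2"
begin

lemma update_eq:
  "update x r (y * dim\<^sup>2 + q) =
     x y * mat_adjoint (\<sigma> q) * mat_adjoint (x y) * mat_adjoint (\<sigma> (r y))"
  using q by (simp only: update_def mult_add_div_mod)

lemma unitary_update: "unitary_mat dim (update x r (y * dim\<^sup>2 + q))"
  unfolding update_eq using x r q
  by (intro unitary_mult unitary_adjoint error_basis_unitary[OF \<sigma>])

text \<open>For \<open>q = 0\<close> the two copies of \<open>x y\<close> cancel and only the
  adjoint of \<open>\<sigma> (r y)\<close> is left; this is where a step gains its success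
  probability. For local \<open>x y\<close> all four factors are local, so an earlier success is not
  lost.\<close>

lemma local_update:
  assumes "local_unitary dA dB (x y) \<or> q = 0"
  shows "local_unitary dA dB (update x r (y * dim\<^sup>2 + q))"
proof -
  have r_loc: "local_unitary dA dB (mat_adjoint (\<sigma> (r y)))"
    by (intro local_unitary_adjoint \<sigma>_local r)
  show ?thesis
  proof (cases "local_unitary dA dB (x y)")
    case True
    then show ?thesis unfolding update_eq
      by (intro local_unitary_mult local_unitary_adjoint r_loc) (auto intro: \<sigma>_local q)
  next
    case False
    then have "q = 0" using assms by simp
    then have "\<sigma> q = 1\<^sub>m dim" using error_basis_one[OF \<sigma>] by simp
    then have "x y * mat_adjoint (\<sigma> q) * mat_adjoint (x y) = 1\<^sub>m dim"
      using x by (auto simp: unitary_mat_def)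
    then show ?thesis unfolding update_eq
      using r_loc left_mult_one_mat[OF unitary_carrier[OF local_unitary_unitary[OF r_loc]]] by simp
  qed
qed

text \<open>The last factor is what the step has done to the register. If the later steps achieve
  the updated unitary up to \<open>W\<close>, the whole therefore achieves \<open>x y\<close> up to
  the same \<open>W\<close>.\<close>

lemma update_cancel:
  assumes W: "W \<in> carrier_mat dim dim"
  shows "W * update x r (y * dim\<^sup>2 + q) * (\<sigma> (r y) * x y * \<sigma> q) = W * x y"
proof -
  have c: "\<sigma> (r y) \<in> carrier_mat dim dim" "\<sigma> q \<in> carrier_mat dim dim" "x y \<in> carrier_mat dim dim"
    using \<sigma>_carrier r q unitary_carrier[OF x] by auto
  have a: "mat_adjoint (\<sigma> (r y)) \<in> carrier_mat dim dim" "mat_adjoint (\<sigma> q) \<in> carrier_mat dim dim"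
    "mat_adjoint (x y) \<in> carrier_mat dim dim" using c by auto
  have "W * update x r (y * dim\<^sup>2 + q) * (\<sigma> (r y) * x y * \<sigma> q) =
      W * x y * mat_adjoint (\<sigma> q) * mat_adjoint (x y) * mat_adjoint (\<sigma> (r y)) * \<sigma> (r y) * x y * \<sigma> q"
    unfolding update_eq using c a W by (simp add: assoc_mult_mat[of _ dim dim _ dim _ dim])
  also have "W * x y * mat_adjoint (\<sigma> q) * mat_adjoint (x y) * mat_adjoint (\<sigma> (r y)) * \<sigma> (r y) =
      W * x y * mat_adjoint (\<sigma> q) * mat_adjoint (x y)"
    using c a W by (intro unitary_cancel(1)[OF error_basis_unitary[OF \<sigma> r]]) auto
  also have "\<dots> * x y = W * x y * mat_adjoint (\<sigma> q)"
    using c a W by (intro unitary_cancel(1)[OF x]) auto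
  also have "\<dots> * \<sigma> q = W * x y"
    using c a W by (intro unitary_cancel(1)[OF error_basis_unitary[OF \<sigma> q]]) auto
  finally show ?thesis .
qed

end

abbreviation pairs :: "(nat \<times> nat) set" where "pairs \<equiv> {..<dim} \<times> {..<dim}"

text \<open>The pair \<open>f y\<close> consists of a basis index of the channel to Alice and one of
  the channel back to Bob. The product over all channels is what allows Alice to act without Bob's
  label.\<close>

definition step_A ::
  "nat \<Rightarrow> ((nat \<Rightarrow> complex mat) \<Rightarrow> 'i \<Rightarrow> nat \<Rightarrow> 'e \<Rightarrow> complex) \<Rightarrow> (nat \<Rightarrow> complex mat) \<Rightarrow>
    (nat \<Rightarrow> nat) \<times> 'i \<Rightarrow> nat \<Rightarrow> (nat \<Rightarrow> nat \<times> nat) \<times> 'e \<Rightarrow> complex" where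
  "step_A k K x = (\<lambda>(r, i) a (f, e). (\<Prod>y<k. amp (x y) (r y) (f y)) * K (update x r) i a e)"

text \<open>Bob measures all channels but \<open>y\<close> in the computational basis. The outcome \<open>g\<close> ranges over all
  channels, so that the outcome set does not depend on \<open>y\<close>; it never occurs unless \<open>g y = (0, 0)\<close>.\<close>

definition step_B ::
  "(nat \<Rightarrow> 'j \<Rightarrow> nat \<Rightarrow> nat \<times> 'e \<Rightarrow> complex) \<Rightarrow> nat \<Rightarrow>
    nat \<times> (nat \<Rightarrow> nat \<times> nat) \<times> 'j \<Rightarrow> nat \<Rightarrow> nat \<times> (nat \<Rightarrow> nat \<times> nat) \<times> 'e \<Rightarrow> complex" where
  "step_B L y = (\<lambda>(q, g, j) b (\<delta>, f, e). if g = f(y := (0, 0))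
     then bell q \<delta> (fst (f y)) * L (y * dim\<^sup>2 + q) j b (snd (f y), e) else 0)"

text \<open>The later operation depends on all outcomes \<open>r\<close>, so its own completeness is
  used first. What is left is a product of independent measurements, one for each channel.\<close>

lemma kraus_step_A:
  assumes x: "\<And>y. y < k \<Longrightarrow> unitary_mat dim (x y)"
    and K: "\<And>r. r \<in> PiE {..<k} (\<lambda>_. {..<dim\<^sup>2}) \<Longrightarrow> kraus I R E (K (update x r))"
  shows "kraus (PiE {..<k} (\<lambda>_. {..<dim\<^sup>2}) \<times> I) R (PiE {..<k} (\<lambda>_. pairs) \<times> E) (step_A k K x)"
  unfolding kraus_def
proof (intro ballI)
  let ?R = "PiE {..<k} (\<lambda>_. {..<dim\<^sup>2})" and ?F = "PiE {..<k} (\<lambda>_. pairs)"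
  fix z z' assume z: "z \<in> ?F \<times> E" "z' \<in> ?F \<times> E"
  obtain f e f' e' where zs: "z = (f, e)" "z' = (f', e')" by (metis surj_pair)
  have f: "f \<in> ?F" "f' \<in> ?F" and e: "e \<in> E" "e' \<in> E" using z zs by auto
  have "(\<Sum>i\<in>?R \<times> I. \<Sum>a\<in>R. cnj (step_A k K x i a z) * step_A k K x i a z') =
      (\<Sum>r\<in>?R. \<Sum>i\<in>I. \<Sum>a\<in>R. (\<Prod>y<k. cnj (amp (x y) (r y) (f y)) * amp (x y) (r y) (f' y)) *
        (cnj (K (update x r) i a e) * K (update x r) i a e'))"
    unfolding sum.cartesian_product' by (simp add: zs step_A_def prod.distrib mult_ac)
  also have "\<dots> = (\<Sum>r\<in>?R. (\<Prod>y<k. cnj (amp (x y) (r y) (f y)) * amp (x y) (r y) (f' y)) *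
        (if e = e' then 1 else 0))"
    by (rule sum.cong[OF refl])
      (simp only: sum_distrib_left[symmetric] krausD[OF K e])
  also have "\<dots> = (\<Prod>y<k. \<Sum>r<dim\<^sup>2. cnj (amp (x y) r (f y)) * amp (x y) r (f' y)) *
        (if e = e' then 1 else 0)"
    by (simp only: sum_distrib_right[symmetric] prod_sum_PiE finite_lessThan)
  also have "(\<Prod>y<k. \<Sum>r<dim\<^sup>2. cnj (amp (x y) r (f y)) * amp (x y) r (f' y)) =
      (\<Prod>y<k. if f y = f' y then 1 else 0)"
    using x f by (intro prod.cong refl amp_complete) (auto simp: PiE_iff)
  also have "\<dots> = (if f = f' then 1 else 0)"
  proof (cases "f = f'")
    case False
    then obtain y where "y \<in> {..<k}" "f y \<noteq> f' y" using f by (metis PiE_ext)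
    then have "(\<Prod>y<k. if f y = f' y then (1::complex) else 0) = 0" by (intro prod_zero) auto
    then show ?thesis using False by simp
  qed simp
  finally show "(\<Sum>i\<in>?R \<times> I. \<Sum>a\<in>R. cnj (step_A k K x i a z) * step_A k K x i a z') =
      (if z = z' then 1 else 0)"
    by (simp add: zs)
qed

text \<open>Three measurements separate the input basis: \<open>g\<close> determines
  \<open>f\<close> away from \<open>y\<close>, the Bell outcome handles \<open>\<delta>\<close> and
  the first half of \<open>f y\<close>, and \<open>L\<close> handles the second half together with
  \<open>e\<close>.\<close>

lemma kraus_step_B:
  assumes y: "y < k"
    and L: "\<And>q. q < dim\<^sup>2 \<Longrightarrow> kraus J R ({..<dim} \<times> E) (L (y * dim\<^sup>2 + q))"
  shows "kraus ({..<dim\<^sup>2} \<times> PiE {..<k} (\<lambda>_. pairs) \<times> J) R ({..<dim} \<times> PiE {..<k} (\<lambda>_. pairs) \<times> E)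
    (step_B L y)"
  unfolding kraus_def
proof (intro ballI)
  let ?F = "PiE {..<k} (\<lambda>_. pairs)"
  fix z z' assume z: "z \<in> {..<dim} \<times> ?F \<times> E" "z' \<in> {..<dim} \<times> ?F \<times> E"
  obtain \<delta> f e \<delta>' f' e' where zs: "z = (\<delta>, f, e)" "z' = (\<delta>', f', e')" by (metis surj_pair)
  have b: "\<delta> < dim" "\<delta>' < dim" and f: "f \<in> ?F" "f' \<in> ?F" and e: "e \<in> E" "e' \<in> E" using z zs by auto
  have fy: "f y \<in> pairs" "f' y \<in> pairs" using f y by auto
  have finF: "finite ?F" by (intro finite_PiE) auto
  define B where "B = (\<lambda>q j b. cnj (L (y * dim\<^sup>2 + q) j b (snd (f y), e)) *
    L (y * dim\<^sup>2 + q) j b (snd (f' y), e'))"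
  have up: "f(y := (0, 0)) \<in> ?F" using f y dim_pos dims_pos by (auto simp: PiE_iff extensional_def)
  let ?same = "f(y := (0, 0)) = f'(y := (0, 0))"
  have "(\<Sum>i\<in>{..<dim\<^sup>2} \<times> ?F \<times> J. \<Sum>b\<in>R. cnj (step_B L y i b z) * step_B L y i b z') =
      (\<Sum>q<dim\<^sup>2. \<Sum>g\<in>?F. \<Sum>j\<in>J. \<Sum>b\<in>R. if g = f(y := (0, 0)) then
        (if ?same then cnj (bell q \<delta> (fst (f y))) * bell q \<delta>' (fst (f' y)) * B q j b else 0) else 0)"
    unfolding sum.cartesian_product' zs step_B_def B_def prod.case
    by (intro sum.cong refl) auto
  also have "\<dots> = (\<Sum>q<dim\<^sup>2. \<Sum>g\<in>?F. if g = f(y := (0, 0)) then (\<Sum>j\<in>J. \<Sum>b\<in>R.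
        (if ?same then cnj (bell q \<delta> (fst (f y))) * bell q \<delta>' (fst (f' y)) * B q j b else 0)) else 0)"
    by (intro sum.cong refl) auto
  also have "\<dots> = (\<Sum>q<dim\<^sup>2. \<Sum>j\<in>J. \<Sum>b\<in>R.
        (if ?same then cnj (bell q \<delta> (fst (f y))) * bell q \<delta>' (fst (f' y)) * B q j b else 0))"
    using up finF by (simp del: fun_upd_apply)
  also have "\<dots> = (if ?same then (\<Sum>q<dim\<^sup>2. cnj (bell q \<delta> (fst (f y))) * bell q \<delta>' (fst (f' y)) *
        (\<Sum>j\<in>J. \<Sum>b\<in>R. B q j b)) else 0)"
    by (simp add: sum_distrib_left)
  also have "\<dots> = (if ?same then (\<Sum>q<dim\<^sup>2. cnj (bell q \<delta> (fst (f y))) * bell q \<delta>' (fst (f' y)) *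
        (if snd (f y) = snd (f' y) \<and> e = e' then 1 else 0)) else 0)"
  proof -
    have "(\<Sum>j\<in>J. \<Sum>b\<in>R. B q j b) = (if snd (f y) = snd (f' y) \<and> e = e' then 1 else 0)"
      if "q < dim\<^sup>2" for q
      using krausD[OF L[OF that], of "(snd (f y), e)" "(snd (f' y), e')"] fy e
      unfolding B_def by (auto simp: mem_Times_iff)
    then show ?thesis by simp
  qed
  also have "\<dots> = (if ?same then (if \<delta> = \<delta>' \<and> fst (f y) = fst (f' y) then 1 else 0) *
        (if snd (f y) = snd (f' y) \<and> e = e' then 1 else 0) else 0)"
    using b fy by (simp only: sum_distrib_right[symmetric]) (auto simp: bell_complete mem_Times_iff)
  also have "\<dots> = (if z = z' then 1 else 0)"
  proof -
    have "f = f' \<longleftrightarrow> ?same \<and> fst (f y) = fst (f' y) \<and> snd (f y) = snd (f' y)"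
      by (metis fun_upd_triv fun_upd_upd prod_eqI)
    then show ?thesis by (auto simp: zs)
  qed
  finally show "(\<Sum>i\<in>{..<dim\<^sup>2} \<times> ?F \<times> J. \<Sum>b\<in>R. cnj (step_B L y i b z) * step_B L y i b z') =
      (if z = z' then 1 else 0)" .
qed

text \<open>The outcome \<open>g\<close> fixes all channels but \<open>y\<close>, so their
  amplitudes become a scalar. In channel \<open>y\<close> the sum over the first index is
  \<open>amp_bell\<close>, and the second index is the register on which the later steps
  act.\<close>

lemma sum_step:
  assumes y: "y < k" and "finite E" and x: "unitary_mat dim (x y)"
    and r: "r \<in> PiE {..<k} (\<lambda>_. {..<dim\<^sup>2})" and q: "q < dim\<^sup>2"
    and g: "g \<in> PiE {..<k} (\<lambda>_. pairs)" and \<delta>: "\<delta> < dim"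
  shows "(\<Sum>z\<in>PiE {..<k} (\<lambda>_. pairs) \<times> E. step_A k K x (r, i) a z * step_B L y (q, g, j) b (\<delta>, z)) =
    (if g y = (0, 0) then (\<Prod>y'\<in>{..<k} - {y}. amp (x y') (r y') (g y')) / dim *
      (\<Sum>\<rho><dim. (\<Sum>e\<in>E. K (update x r) i a e * L (y * dim\<^sup>2 + q) j b (\<rho>, e)) *
        (\<sigma> (r y) * x y * \<sigma> q) $$ (\<rho>, \<delta>)) else 0)"
proof -
  let ?F = "PiE {..<k} (\<lambda>_. pairs)" and ?G = "\<Prod>y'\<in>{..<k} - {y}. amp (x y') (r y') (g y')"
  define M where "M \<rho> = (\<Sum>e\<in>E. K (update x r) i a e * L (y * dim\<^sup>2 + q) j b (\<rho>, e))" for \<rho>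
  have ry: "r y < dim\<^sup>2" using r y by auto
  have "(\<Sum>z\<in>?F \<times> E. step_A k K x (r, i) a z * step_B L y (q, g, j) b (\<delta>, z)) =
      (\<Sum>f\<in>?F. if g = f(y := (0, 0)) then
        (\<Prod>y'<k. amp (x y') (r y') (f y')) * bell q \<delta> (fst (f y)) * M (snd (f y)) else 0)"
    unfolding sum.cartesian_product' M_def sum_distrib_left
    by (intro sum.cong refl) (auto simp: step_A_def step_B_def mult_ac)
  also have "\<dots> = (if g y = (0, 0) then (\<Sum>s\<in>pairs. (\<Prod>y'<k. amp (x y') (r y') ((g(y := s)) y')) *
      bell q \<delta> (fst ((g(y := s)) y)) * M (snd ((g(y := s)) y))) else 0)"
    using y g dims_pos by (intro sum_PiE_fun_upd) auto
  also have "(\<Sum>s\<in>pairs. (\<Prod>y'<k. amp (x y') (r y') ((g(y := s)) y')) *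
      bell q \<delta> (fst ((g(y := s)) y)) * M (snd ((g(y := s)) y))) =
      (\<Sum>s\<in>pairs. ?G * (amp (x y) (r y) s * bell q \<delta> (fst s) * M (snd s)))"
  proof (rule sum.cong[OF refl])
    fix s assume "s \<in> pairs"
    have "(\<Prod>y'<k. amp (x y') (r y') ((g(y := s)) y')) = amp (x y) (r y) s * ?G"
      using y by (subst prod.remove[of _ y]) auto
    then show "(\<Prod>y'<k. amp (x y') (r y') ((g(y := s)) y')) *
      bell q \<delta> (fst ((g(y := s)) y)) * M (snd ((g(y := s)) y)) =
      ?G * (amp (x y) (r y) s * bell q \<delta> (fst s) * M (snd s))" by simp
  qed
  also have "\<dots> = ?G * (\<Sum>\<rho><dim. (\<Sum>c<dim. amp (x y) (r y) (c, \<rho>) * bell q \<delta> c) * M \<rho>)"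
    unfolding sum_distrib_left[symmetric] sum.cartesian_product' sum_distrib_right
    by (subst sum.swap) simp
  also have "\<dots> = ?G / dim * (\<Sum>\<rho><dim. M \<rho> * (\<sigma> (r y) * x y * \<sigma> q) $$ (\<rho>, \<delta>))"
    using amp_bell[OF x ry q _ \<delta>]
    by (simp add: sum_distrib_left sum_divide_distrib mult_ac del: index_mult_mat(1) of_nat_mult)
  finally show ?thesis unfolding M_def .
qed

lemma sum_unused_channels:
  fixes x :: "nat \<Rightarrow> complex mat"
  assumes y: "y < k" and x: "\<And>y. y < k \<Longrightarrow> unitary_mat dim (x y)"
    and r: "r \<in> PiE {..<k} (\<lambda>_. {..<dim\<^sup>2})"
  shows "(\<Sum>g\<in>PiE {..<k} (\<lambda>_. pairs). if g y = (0, 0)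
    then (cmod (\<Prod>y'\<in>{..<k} - {y}. amp (x y') (r y') (g y')))\<^sup>2 else 0) = 1"
proof -
  \<comment> \<open>The indicator placed at \<open>y\<close> turns the constraint on
    \<open>g y\<close> into one more factor, and the sum over all \<open>g\<close> becomes a product
    over channels.\<close>
  define h where "h = (\<lambda>y' s. if y' = y then (if s = (0, 0) then 1 else 0) else (cmod (amp (x y') (r y') s))\<^sup>2)"
  have "(\<Sum>g\<in>PiE {..<k} (\<lambda>_. pairs). if g y = (0, 0)
      then (cmod (\<Prod>y'\<in>{..<k} - {y}. amp (x y') (r y') (g y')))\<^sup>2 else 0) =
      (\<Sum>g\<in>PiE {..<k} (\<lambda>_. pairs). \<Prod>y'<k. h y' (g y'))"
  proof (rule sum.cong[OF refl])
    fix g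
    have "(\<Prod>y'<k. h y' (g y')) = h y (g y) * (\<Prod>y'\<in>{..<k} - {y}. h y' (g y'))"
      using y by (intro prod.remove) auto
    also have "(\<Prod>y'\<in>{..<k} - {y}. h y' (g y')) = (\<Prod>y'\<in>{..<k} - {y}. (cmod (amp (x y') (r y') (g y')))\<^sup>2)"
      by (intro prod.cong) (auto simp: h_def)
    finally show "(if g y = (0, 0) then (cmod (\<Prod>y'\<in>{..<k} - {y}. amp (x y') (r y') (g y')))\<^sup>2 else 0) =
        (\<Prod>y'<k. h y' (g y'))"
      by (simp add: h_def prod_norm[symmetric] prod_power_distrib)
  qed
  also have "\<dots> = (\<Prod>y'<k. \<Sum>s\<in>pairs. h y' s)"
    by (rule prod_sum_PiE[symmetric]) auto
  also have "\<dots> = 1"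
  proof (rule prod.neutral, rule ballI)
    fix y' assume "y' \<in> {..<k}"
    then have ry: "r y' < dim\<^sup>2" and xy: "unitary_mat dim (x y')" using r x by auto
    show "(\<Sum>s\<in>pairs. h y' s) = 1"
    proof (cases "y' = y")
      case True
      have "(0, 0) \<in> pairs" using dims_pos by simp
      then show ?thesis using True by (simp add: h_def)
    next
      case False
      then show ?thesis using amp_norm[OF xy ry] by (simp add: h_def)
    qed
  qed
  finally show ?thesis .
qed

lemma succeeds_step:
  fixes E :: "'e set" and I :: "'i set" and J :: "'j set"
  assumes y: "y < k" and E: "finite E" and x: "\<And>y. y < k \<Longrightarrow> unitary_mat dim (x y)"
    and succ: "\<And>r q. r \<in> PiE {..<k} (\<lambda>_. {..<dim\<^sup>2}) \<Longrightarrow> q < dim\<^sup>2 \<Longrightarrow>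
      succeeds dA dB I J (\<lambda>i j a b \<delta>. \<Sum>e\<in>E. K (update x r) i a e * L (y * dim\<^sup>2 + q) j b (\<delta>, e))
        (update x r (y * dim\<^sup>2 + q)) (w q)"
  shows "succeeds dA dB (PiE {..<k} (\<lambda>_. {..<dim\<^sup>2}) \<times> I) ({..<dim\<^sup>2} \<times> PiE {..<k} (\<lambda>_. pairs) \<times> J)
    (\<lambda>i j a b \<delta>. \<Sum>z\<in>PiE {..<k} (\<lambda>_. pairs) \<times> E. step_A k K x i a z * step_B L y j b (\<delta>, z)) (x y)
    (real ((dim\<^sup>2) ^ k) * (\<Sum>q<dim\<^sup>2. w q) / real (dim\<^sup>2))"
proof -
  let ?R = "PiE {..<k} (\<lambda>_. {..<dim\<^sup>2})" and ?F = "PiE {..<k} (\<lambda>_. pairs)"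
  define M where "M = (\<lambda>r q i j a b \<delta>. \<Sum>e\<in>E. K (update x r) i a e * L (y * dim\<^sup>2 + q) j b (\<delta>, e))"
  define P where "P = (\<lambda>r q (c :: 'i \<Rightarrow> 'j \<Rightarrow> complex). (\<forall>i\<in>I. \<forall>j\<in>J. c i j \<noteq> 0 \<longrightarrow>
    (\<exists>W. local_unitary dA dB W \<and> (\<forall>a<dA. \<forall>b<dB. \<forall>\<delta><dim.
      M r q i j a b \<delta> = c i j * (W * update x r (y * dim\<^sup>2 + q)) $$ (a * dB + b, \<delta>)))) \<and>
      w q \<le> (\<Sum>i\<in>I. \<Sum>j\<in>J. (cmod (c i j))\<^sup>2))"
  have "\<exists>c. P r q c" if "r \<in> ?R" "q < dim\<^sup>2" for r q
    using succ[OF that] unfolding succeeds_def P_def M_def .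
  then obtain c where c: "\<And>r q. r \<in> ?R \<Longrightarrow> q < dim\<^sup>2 \<Longrightarrow> P r q (c r q)"
    by metis
  define G where "G = (\<lambda>r g. \<Prod>y'\<in>{..<k} - {y}. amp (x y') (r y') (g y'))"
  define C where "C = (\<lambda>(r, i) (q, g, j). if g y = (0, 0) then G r g / dim * c r q i j else 0)"
  show ?thesis unfolding succeeds_def
  proof (intro exI[of _ C] conjI ballI impI)
    fix i' j' assume "i' \<in> ?R \<times> I" "j' \<in> {..<dim\<^sup>2} \<times> ?F \<times> J" and nz: "C i' j' \<noteq> 0"
    then obtain r i q g j where eqs: "i' = (r, i)" "j' = (q, g, j)"
      and mem: "r \<in> ?R" "i \<in> I" "q < dim\<^sup>2" "g \<in> ?F" "j \<in> J" by auto
    have gy: "g y = (0, 0)" and cnz: "c r q i j \<noteq> 0"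
      using nz unfolding eqs C_def by (auto split: if_splits)
    have ry: "r y < dim\<^sup>2" using mem(1) y by auto
    obtain W where W: "local_unitary dA dB W"
      "\<And>a b \<delta>. a < dA \<Longrightarrow> b < dB \<Longrightarrow> \<delta> < dim \<Longrightarrow>
        M r q i j a b \<delta> = c r q i j * (W * update x r (y * dim\<^sup>2 + q)) $$ (a * dB + b, \<delta>)"
      using c[OF mem(1,3)] mem(2,5) cnz unfolding P_def by blast
    have Wc: "W \<in> carrier_mat dim dim" using unitary_carrier[OF local_unitary_unitary[OF W(1)]] .
    have uc: "update x r (y * dim\<^sup>2 + q) \<in> carrier_mat dim dim"
      using unitary_carrier[OF unitary_update[of x y r q, OF x[OF y] ry mem(3)]] .
    have sc: "\<sigma> (r y) * x y * \<sigma> q \<in> carrier_mat dim dim"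
      using \<sigma>_carrier[OF ry] \<sigma>_carrier[OF mem(3)] unitary_carrier[OF x[OF y]] by auto
    have "(\<Sum>z\<in>?F \<times> E. step_A k K x i' a z * step_B L y j' b (\<delta>, z)) = C i' j' * (W * x y) $$ (a * dB + b, \<delta>)"
      if ab: "a < dA" "b < dB" "\<delta> < dim" for a b \<delta>
    proof -
      have row: "a * dB + b < dim" using ab by (intro mult_add_less_mult)
      have "(\<Sum>z\<in>?F \<times> E. step_A k K x i' a z * step_B L y j' b (\<delta>, z)) =
          G r g / dim * (\<Sum>\<rho><dim. M r q i j a b \<rho> * (\<sigma> (r y) * x y * \<sigma> q) $$ (\<rho>, \<delta>))"
        unfolding eqs M_def G_def
        by (subst sum_step[where x = x and y = y, OF y E x[OF y] mem(1,3,4) ab(3)]) (simp only: gy refl if_True)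
      also have "\<dots> = G r g / dim * c r q i j * (\<Sum>\<rho><dim. (W * update x r (y * dim\<^sup>2 + q)) $$ (a * dB + b, \<rho>) *
          (\<sigma> (r y) * x y * \<sigma> q) $$ (\<rho>, \<delta>))"
        using ab W(2) by (simp add: sum_distrib_left mult_ac del: index_mult_mat(1) of_nat_mult)
      also have "(\<Sum>\<rho><dim. (W * update x r (y * dim\<^sup>2 + q)) $$ (a * dB + b, \<rho>) *
          (\<sigma> (r y) * x y * \<sigma> q) $$ (\<rho>, \<delta>)) =
          (W * update x r (y * dim\<^sup>2 + q) * (\<sigma> (r y) * x y * \<sigma> q)) $$ (a * dB + b, \<delta>)"
        using row ab Wc uc sc by (intro mat_mult_index_sum[symmetric]) auto
      also have "\<dots> = (W * x y) $$ (a * dB + b, \<delta>)"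
        using update_cancel[of x y r q W, OF x[OF y] ry mem(3) Wc] by simp
      finally show ?thesis unfolding eqs C_def using gy by simp
    qed
    then show "\<exists>W. local_unitary dA dB W \<and> (\<forall>a<dA. \<forall>b<dB. \<forall>\<delta><dim.
        (\<Sum>z\<in>?F \<times> E. step_A k K x i' a z * step_B L y j' b (\<delta>, z)) =
          C i' j' * (W * x y) $$ (a * dB + b, \<delta>))"
      using W(1) by blast
  next
    have "real ((dim\<^sup>2) ^ k) * (\<Sum>q<dim\<^sup>2. w q) / real (dim\<^sup>2) = (\<Sum>r\<in>?R. \<Sum>q<dim\<^sup>2. w q / (real dim)\<^sup>2)"
      by (simp add: card_PiE del: of_nat_mult flip: sum_divide_distrib)
    also have "\<dots> \<le> (\<Sum>r\<in>?R. \<Sum>q<dim\<^sup>2. (\<Sum>i\<in>I. \<Sum>j\<in>J. (cmod (c r q i j))\<^sup>2) / (real dim)\<^sup>2)"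
      using c unfolding P_def by (intro sum_mono divide_right_mono) auto
    also have "\<dots> = (\<Sum>r\<in>?R. \<Sum>q<dim\<^sup>2. (\<Sum>g\<in>?F. if g y = (0, 0) then (cmod (G r g))\<^sup>2 else 0) *
        (\<Sum>i\<in>I. \<Sum>j\<in>J. (cmod (c r q i j))\<^sup>2 / (real dim)\<^sup>2))"
      using sum_unused_channels[OF y x] unfolding G_def
      by (intro sum.cong refl) (simp add: sum_divide_distrib)
    also have "\<dots> = (\<Sum>r\<in>?R. \<Sum>q<dim\<^sup>2. \<Sum>g\<in>?F. \<Sum>i\<in>I. \<Sum>j\<in>J. (cmod (C (r, i) (q, g, j)))\<^sup>2)"
      unfolding sum_distrib_right unfolding sum_distrib_left
      by (intro sum.cong refl)
        (simp add: C_def norm_mult norm_divide power_mult_distrib power_divide del: of_nat_mult)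
    also have "\<dots> = (\<Sum>r\<in>?R. \<Sum>i\<in>I. \<Sum>q<dim\<^sup>2. \<Sum>g\<in>?F. \<Sum>j\<in>J. (cmod (C (r, i) (q, g, j)))\<^sup>2)"
      by (rule sum.cong[OF refl], subst (2) sum.swap, rule sum.cong[OF refl], rule sum.swap)
    also have "\<dots> = (\<Sum>i\<in>?R \<times> I. \<Sum>j\<in>{..<dim\<^sup>2} \<times> ?F \<times> J. (cmod (C i j))\<^sup>2)"
      unfolding sum.cartesian_product' ..
    finally show "real ((dim\<^sup>2) ^ k) * (\<Sum>q<dim\<^sup>2. w q) / real (dim\<^sup>2) \<le>
        (\<Sum>i\<in>?R \<times> I. \<Sum>j\<in>{..<dim\<^sup>2} \<times> ?F \<times> J. (cmod (C i j))\<^sup>2)" .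
  qed
qed

text \<open>Among the \<open>dim\<^sup>2\<close> equally likely outcomes \<open>q\<close>, the value
  0 makes the remaining unitary local, so that the inner scheme is certain to succeed; the others
  leave it with at least \<open>p\<close>.\<close>

lemma scheme_step:
  fixes E :: "'e set" and I :: "'i set" and J :: "'j set"
  assumes S: "scheme dA dB (k * dim\<^sup>2) E I J K L p" and p: "p \<le> 1"
  shows "scheme dA dB k (PiE {..<k} (\<lambda>_. pairs) \<times> E) (PiE {..<k} (\<lambda>_. {..<dim\<^sup>2}) \<times> I)
    ({..<dim\<^sup>2} \<times> PiE {..<k} (\<lambda>_. pairs) \<times> J) (step_A k K) (step_B L)
    (1 / (real dim)\<^sup>2 + (1 - 1 / (real dim)\<^sup>2) * p)" (is "scheme _ _ _ _ _ _ _ _ ?p'")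
proof -
  let ?R = "PiE {..<k} (\<lambda>_. {..<dim\<^sup>2})" and ?F = "PiE {..<k} (\<lambda>_. pairs)"
  have fin: "finite E" "finite I" "finite J" using S unfolding scheme_def by auto
  have finRF: "finite ?R" "finite ?F" by (auto intro: finite_PiE)
  have cardF: "card ?F = (dim\<^sup>2) ^ k" by (simp add: card_PiE power2_eq_square)
  obtain s where s: "card E = 2 ^ s" using S unfolding scheme_def by blast
  \<comment> \<open>A channel pair has a basis of \<open>dim\<^sup>2\<close> elements, so each of
    the \<open>k\<close> labels costs \<open>2 * (nA + nB)\<close> EPR pairs.\<close>
  have "card (?F \<times> E) = 2 ^ ((nA + nB) * 2 * k + s)"
    unfolding card_cartesian_product cardF s
    by (simp only: dims power_add[symmetric] power_mult[symmetric])
  then have card: "\<exists>s. card (?F \<times> E) = 2 ^ s" by blast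
  have upd: "\<forall>z<k * dim\<^sup>2. unitary_mat dim (update x r z)"
    if x: "\<forall>y<k. unitary_mat dim (x y)" and r: "r \<in> ?R" for x r
  proof (intro allI impI)
    fix z assume z: "z < k * dim\<^sup>2"
    have y: "z div dim\<^sup>2 < k" and q: "z mod dim\<^sup>2 < dim\<^sup>2" using less_mult_div_mod[OF z] .
    have ry: "r (z div dim\<^sup>2) < dim\<^sup>2" using r y by auto
    have "unitary_mat dim (update x r (z div dim\<^sup>2 * dim\<^sup>2 + z mod dim\<^sup>2))"
      using x y by (intro unitary_update ry q) auto
    then show "unitary_mat dim (update x r z)" by (simp only: div_mult_mod_eq)
  qed
  show ?thesis unfolding scheme_def
  proof (intro conjI allI impI)
    fix y assume y: "y < k"
    show "kraus ({..<dim\<^sup>2} \<times> ?F \<times> J) {..<dB} ({..<dim} \<times> ?F \<times> E) (step_B L y)"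
    proof (rule kraus_step_B[OF y])
      fix q assume "q < dim\<^sup>2"
      then have "y * dim\<^sup>2 + q < k * dim\<^sup>2" using y by (intro mult_add_less_mult)
      then show "kraus J {..<dB} ({..<dim} \<times> E) (L (y * dim\<^sup>2 + q))"
        using S unfolding scheme_def by blast
    qed
  next
    fix x assume x: "\<forall>y<k. unitary_mat dim (x y)"
    show "kraus (?R \<times> I) {..<dA} (?F \<times> E) (step_A k K x)"
    proof (rule kraus_step_A)
      fix r assume "r \<in> ?R"
      then show "kraus I {..<dA} E (K (update x r))"
        using S upd[OF x] unfolding scheme_def by blast
    qed (use x in simp)
    fix y assume y: "y < k"
    \<comment> \<open>This is only a lower bound: the updated unitary may be local for other
      \<open>q\<close> too, and \<open>p \<le> 1\<close> covers that case.\<close>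
    define w where "w q = real (card E) * (if local_unitary dA dB (x y) \<or> q = 0 then 1 else p)" for q :: nat
    have "succeeds dA dB I J (\<lambda>i j a b \<delta>. \<Sum>e\<in>E. K (update x r) i a e * L (y * dim\<^sup>2 + q) j b (\<delta>, e))
        (update x r (y * dim\<^sup>2 + q)) (w q)" if r: "r \<in> ?R" and q: "q < dim\<^sup>2" for r q
    proof (rule succeeds_mono)
      have "y * dim\<^sup>2 + q < k * dim\<^sup>2" using y q by (intro mult_add_less_mult)
      then show "succeeds dA dB I J (\<lambda>i j a b \<delta>. \<Sum>e\<in>E. K (update x r) i a e * L (y * dim\<^sup>2 + q) j b (\<delta>, e))
          (update x r (y * dim\<^sup>2 + q))
          (real (card E) * (if local_unitary dA dB (update x r (y * dim\<^sup>2 + q)) then 1 else p))"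
        using S upd[OF x r] unfolding scheme_def by blast
      have ry: "r y < dim\<^sup>2" and xy: "unitary_mat dim (x y)" using r x y by auto
      show "w q \<le> real (card E) * (if local_unitary dA dB (update x r (y * dim\<^sup>2 + q)) then 1 else p)"
        unfolding w_def using p local_update[of x y r q, OF xy ry q]
        by (intro mult_left_mono) auto
    qed
    then have "succeeds dA dB (?R \<times> I) ({..<dim\<^sup>2} \<times> ?F \<times> J)
        (\<lambda>i j a b \<delta>. \<Sum>z\<in>?F \<times> E. step_A k K x i a z * step_B L y j b (\<delta>, z)) (x y)
        (real ((dim\<^sup>2) ^ k) * (\<Sum>q<dim\<^sup>2. w q) / real (dim\<^sup>2))"
      using x by (intro succeeds_step[OF y fin(1)]) auto
    then show "succeeds dA dB (?R \<times> I) ({..<dim\<^sup>2} \<times> ?F \<times> J)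
        (\<lambda>i j a b \<delta>. \<Sum>z\<in>?F \<times> E. step_A k K x i a z * step_B L y j b (\<delta>, z)) (x y)
        (real (card (?F \<times> E)) * (if local_unitary dA dB (x y) then 1 else ?p'))"
    proof (rule succeeds_mono)
      have Q: "real (dim\<^sup>2) > 0" using dim_pos by simp
      have "(\<Sum>q<dim\<^sup>2. w q) = real (card E) * (real (dim\<^sup>2) * (if local_unitary dA dB (x y) then 1 else ?p'))"
      proof (cases "local_unitary dA dB (x y)")
        case True
        then show ?thesis by (simp add: w_def)
      next
        case False
        have "0 < dim\<^sup>2" using dim_pos by simp
        then have "(\<Sum>q<dim\<^sup>2. w q) = w 0 + (\<Sum>q\<in>{..<dim\<^sup>2} - {0}. w q)"
          by (intro sum.remove) auto
        also have "(\<Sum>q\<in>{..<dim\<^sup>2} - {0}. w q) = (\<Sum>q\<in>{..<dim\<^sup>2} - {0}. real (card E) * p)"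
          using False by (intro sum.cong) (auto simp: w_def)
        also have "\<dots> = (real (dim\<^sup>2) - 1) * (real (card E) * p)"
          using \<open>0 < dim\<^sup>2\<close> by (simp add: of_nat_diff card_Diff_singleton)
        finally have "(\<Sum>q<dim\<^sup>2. w q) = real (card E) * (1 + (real (dim\<^sup>2) - 1) * p)"
          by (simp add: w_def algebra_simps)
        also have "1 + (real (dim\<^sup>2) - 1) * p = real (dim\<^sup>2) * ?p'"
          using dims_pos by (simp add: field_simps)
        finally show ?thesis using False by simp
      qed
      then have "real ((dim\<^sup>2) ^ k) * (\<Sum>q<dim\<^sup>2. w q) / real (dim\<^sup>2) =
          real ((dim\<^sup>2) ^ k) * (real (card E) * (if local_unitary dA dB (x y) then 1 else ?p'))"
        using Q by simp
      also have "\<dots> = real (card (?F \<times> E)) * (if local_unitary dA dB (x y) then 1 else ?p')"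
        unfolding card_cartesian_product cardF of_nat_mult by simp
      finally show "real (card (?F \<times> E)) * (if local_unitary dA dB (x y) then 1 else ?p')
          \<le> real ((dim\<^sup>2) ^ k) * (\<Sum>q<dim\<^sup>2. w q) / real (dim\<^sup>2)" by simp
    qed
  qed (use fin finRF card in auto)
qed

lemma failure_rate: "0 \<le> 1 - 1 / (real dim)\<^sup>2" "1 - 1 / (real dim)\<^sup>2 < 1"
proof -
  have "1 \<le> real dim" using dim_pos by linarith
  then have "1 \<le> (real dim)\<^sup>2" by (rule one_le_power)
  then show "0 \<le> 1 - 1 / (real dim)\<^sup>2" "1 - 1 / (real dim)\<^sup>2 < 1"
    using dims_pos by (simp_all add: divide_le_eq del: of_nat_mult)
qed

text \<open>Each step multiplies the failure probability by
  \<open>1 - 1 / (real dim)\<^sup>2\<close>. The induction must leave \<open>k\<close> arbitrary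
  because the inner scheme serves \<open>dim\<^sup>2\<close> times as many labels.\<close>

lemma scheme_exists:
  "\<exists>(E :: nat set) (I :: nat set) (J :: nat set) K L. scheme dA dB k E I J K L (1 - (1 - 1 / (real dim)\<^sup>2) ^ n)"
proof (induction n arbitrary: k)
  case 0
  show ?case unfolding power_0 diff_self by (intro exI, rule scheme_base)
next
  case (Suc n)
  let ?t = "1 - 1 / (real dim)\<^sup>2"
  obtain E I J :: "nat set" and K L where S: "scheme dA dB (k * dim\<^sup>2) E I J K L (1 - ?t ^ n)"
    using Suc by blast
  have "1 - ?t ^ n \<le> 1" using zero_le_power[OF failure_rate(1)] by simp
  from scheme_nat[OF scheme_step[OF S this]]
  show ?case by (simp add: algebra_simps)
qed

end

text \<open>As in a scheme, the entangled state on \<open>E\<close> is not normalized; the input basis vector \<open>\<delta>\<close> of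
  \<open>A\<close> and \<open>B\<close> is split as \<open>(\<delta> div dB, \<delta> mod dB)\<close>.\<close>

definition protocol ::
  "nat \<Rightarrow> nat \<Rightarrow> 'e set \<Rightarrow> 'i set \<Rightarrow> 'j set \<Rightarrow> ('i \<Rightarrow> nat \<Rightarrow> nat \<times> 'e \<Rightarrow> complex) \<Rightarrow>
    ('j \<Rightarrow> nat \<Rightarrow> nat \<times> 'e \<Rightarrow> complex) \<Rightarrow> complex mat \<Rightarrow> real \<Rightarrow> bool" where
  "protocol dA dB E I J K L U p \<longleftrightarrow>
     finite E \<and> finite I \<and> finite J \<and>
     kraus I {..<dA} ({..<dA} \<times> E) K \<and> kraus J {..<dB} ({..<dB} \<times> E) L \<and>
     succeeds dA dB I J (\<lambda>i j a b \<delta>. \<Sum>e\<in>E. K i a (\<delta> div dB, e) * L j b (\<delta> mod dB, e)) U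
       (real (card E) * p)"

section \<open>The initial teleportation from Alice to Bob\<close>

context error_bases
begin

text \<open>Teleporting \<open>A\<close> leaves the error \<open>T h\<close> on Bob's register, and
  Alice knows \<open>h\<close>. She enters the scheme with \<open>X h\<close>, chosen so that
  \<open>X h * T h = U\<close>.\<close>

lemma protocol_exists:
  assumes U: "unitary_mat dim U"
  shows "\<exists>(E :: (nat \<times> nat) set) (I :: (nat \<times> nat) set) (J :: nat set) K L s. card E = 2 ^ s \<and>
    protocol dA dB E I J K L U (1 - (1 - 1 / (real dim)\<^sup>2) ^ n)"
proof -
  define p where "p = 1 - (1 - 1 / (real dim)\<^sup>2) ^ n"
  have p: "p \<le> 1" unfolding p_def using zero_le_power[OF failure_rate(1)] by simp
  \<comment> \<open>A single label is enough, as Bob has no outcome yet.\<close>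
  obtain E I J :: "nat set" and K L where S: "scheme dA dB 1 E I J K L p"
    unfolding p_def using scheme_exists by blast
  have fin: "finite E" "finite I" "finite J" using S unfolding scheme_def by auto
  obtain s where s: "card E = 2 ^ s" using S unfolding scheme_def by blast
  define T where "T h = kron (\<tau> h) (1\<^sub>m dB)" for h
  define X where "X h = U * mat_adjoint (T h)" for h
  have T: "unitary_mat dim (T h)" if "h < dA\<^sup>2" for h
    unfolding T_def using error_basis_unitary[OF \<tau> that] unitary_one by (rule unitary_kron)
  have X: "unitary_mat dim (X h)" if "h < dA\<^sup>2" for h
    unfolding X_def using T[OF that] by (intro unitary_mult U unitary_adjoint)
  define M where "M h i j a b \<delta> = (\<Sum>e\<in>E. K (\<lambda>_. X h) i a e * L 0 j b (\<delta>, e))" for h i j a b \<delta>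
  define P where "P = (\<lambda>h (c :: nat \<Rightarrow> nat \<Rightarrow> complex). (\<forall>i\<in>I. \<forall>j\<in>J. c i j \<noteq> 0 \<longrightarrow>
    (\<exists>W. local_unitary dA dB W \<and> (\<forall>a<dA. \<forall>b<dB. \<forall>\<delta><dim.
      M h i j a b \<delta> = c i j * (W * X h) $$ (a * dB + b, \<delta>)))) \<and>
      real (card E) * p \<le> (\<Sum>i\<in>I. \<Sum>j\<in>J. (cmod (c i j))\<^sup>2))"
  have KX: "kraus I {..<dA} E (K (\<lambda>_. X h))"
    and "succeeds dA dB I J (M h) (X h) (real (card E) * p)" if "h < dA\<^sup>2" for h
  proof -
    show "kraus I {..<dA} E (K (\<lambda>_. X h))"
      using S by (rule schemeD(1)) (rule X[OF that])
    have "succeeds dA dB I J (M h) (X h) (real (card E) * (if local_unitary dA dB (X h) then 1 else p))"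
      unfolding M_def using schemeD(2)[OF S, of "\<lambda>_. X h" 0] X[OF that] by simp
    then show "succeeds dA dB I J (M h) (X h) (real (card E) * p)"
      using p by (rule_tac succeeds_mono) (auto intro: mult_left_mono)
  qed
  then have "\<exists>c. P h c" if "h < dA\<^sup>2" for h
    using that unfolding succeeds_def P_def by blast
  then obtain c where c: "\<And>h. h < dA\<^sup>2 \<Longrightarrow> P h (c h)" by metis
  let ?E = "{..<dA} \<times> E" and ?I = "{..<dA\<^sup>2} \<times> I"
  \<comment> \<open>Here \<open>a\<close> indexes Alice's input, \<open>t\<close> the halves used to
    teleport it and \<open>e\<close> the resources of the scheme. Bob joins \<open>t\<close> and his
    own \<open>b\<close> into one register index.\<close>
  define K' where "K' = (\<lambda>(h, i) a' (a, t, e). \<tau> h $$ (t, a) / sqrt dA * K (\<lambda>_. X h) i a' e)"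
  define L' where "L' = (\<lambda>j b' (b, t, e). L 0 j b' (t * dB + b, e))"
  have sq: "complex_of_real (sqrt dA) * complex_of_real (sqrt dA) = of_nat dA"
    by (simp only: of_real_mult[symmetric] real_sqrt_mult_self) simp
  have "kraus ?I {..<dA} ({..<dA} \<times> ?E) K'"
    unfolding kraus_def
  proof (intro ballI)
    fix z z' assume z: "z \<in> {..<dA} \<times> ?E" "z' \<in> {..<dA} \<times> ?E"
    obtain a t e a' t' e' where zs: "z = (a, t, e)" "z' = (a', t', e')" by (metis surj_pair)
    have b: "a < dA" "t < dA" "a' < dA" "t' < dA" "e \<in> E" "e' \<in> E" using z zs by auto
    have "(\<Sum>i\<in>?I. \<Sum>r<dA. cnj (K' i r z) * K' i r z') =
        (\<Sum>h<dA\<^sup>2. (cnj (\<tau> h $$ (t, a)) * \<tau> h $$ (t', a')) / dA *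
          (\<Sum>i\<in>I. \<Sum>r<dA. cnj (K (\<lambda>_. X h) i r e) * K (\<lambda>_. X h) i r e'))"
      unfolding sum.cartesian_product' zs K'_def sum_distrib_left
      by (intro sum.cong refl) (simp add: sq[symmetric])
    also have "\<dots> = (\<Sum>h<dA\<^sup>2. cnj (\<tau> h $$ (t, a)) * \<tau> h $$ (t', a')) / dA * (if e = e' then 1 else 0)"
      unfolding sum_distrib_right sum_divide_distrib
      using krausD[OF KX b(5,6)] by (intro sum.cong refl) auto
    also have "\<dots> = (if z = z' then 1 else 0)"
      using b dims_pos by (simp add: error_basis_sum[OF \<tau>] zs)
    finally show "(\<Sum>i\<in>?I. \<Sum>r<dA. cnj (K' i r z) * K' i r z') = (if z = z' then 1 else 0)" .
  qed
  moreover have "kraus J {..<dB} ({..<dB} \<times> ?E) L'"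
    unfolding kraus_def
  proof (intro ballI)
    fix z z' assume z: "z \<in> {..<dB} \<times> ?E" "z' \<in> {..<dB} \<times> ?E"
    obtain b t e b' t' e' where zs: "z = (b, t, e)" "z' = (b', t', e')" by (metis surj_pair)
    have m: "b < dB" "t < dA" "b' < dB" "t' < dA" "e \<in> E" "e' \<in> E" using z zs by auto
    have "kraus J {..<dB} ({..<dim} \<times> E) (L 0)" using S unfolding scheme_def by blast
    then have "(\<Sum>j\<in>J. \<Sum>r<dB. cnj (L' j r z) * L' j r z') =
        (if (t * dB + b, e) = (t' * dB + b', e') then 1 else 0)"
      unfolding zs L'_def prod.case using m by (intro krausD) (auto intro: mult_add_less_mult)
    moreover have "t * dB + b = t' * dB + b' \<longleftrightarrow> t = t' \<and> b = b'"
      using m mult_add_div_mod by metis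
    ultimately show "(\<Sum>j\<in>J. \<Sum>r<dB. cnj (L' j r z) * L' j r z') = (if z = z' then 1 else 0)"
      by (auto simp: zs)
  qed
  moreover have "succeeds dA dB ?I J
      (\<lambda>i j a b \<delta>. \<Sum>e\<in>?E. K' i a (\<delta> div dB, e) * L' j b (\<delta> mod dB, e)) U (real (card ?E) * p)"
    unfolding succeeds_def
  \<comment> \<open>The \<open>dA\<^sup>2\<close> outcomes \<open>h\<close> carry a factor
    \<open>1 / dA\<close> each, which together give the ratio \<open>dA\<close> of the cardinalities
    of \<open>?E\<close> and \<open>E\<close>.\<close>
  proof (intro exI[of _ "\<lambda>(h, i) j. c h i j / sqrt dA"] conjI ballI impI)
    fix i' j assume "i' \<in> ?I" and j: "j \<in> J" and nz: "(case i' of (h, i) \<Rightarrow> \<lambda>j. c h i j / sqrt dA) j \<noteq> 0"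
    then obtain h i where eq: "i' = (h, i)" and h: "h < dA\<^sup>2" and i: "i \<in> I" and cnz: "c h i j \<noteq> 0" by auto
    obtain W where W: "local_unitary dA dB W"
      "\<And>a b \<delta>. a < dA \<Longrightarrow> b < dB \<Longrightarrow> \<delta> < dim \<Longrightarrow>
        M h i j a b \<delta> = c h i j * (W * X h) $$ (a * dB + b, \<delta>)"
      using c[OF h] i j cnz unfolding P_def by blast
    have Wc: "W \<in> carrier_mat dim dim" using unitary_carrier[OF local_unitary_unitary[OF W(1)]] .
    have Uc: "U \<in> carrier_mat dim dim" using unitary_carrier[OF U] .
    have Tc: "T h \<in> carrier_mat dim dim" using unitary_carrier[OF T[OF h]] .
    have \<tau>c: "\<tau> h \<in> carrier_mat dA dA" using unitary_carrier[OF error_basis_unitary[OF \<tau> h]] .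
    have XT: "W * X h * T h = W * U"
    proof -
      have "W * X h = W * U * mat_adjoint (T h)"
        unfolding X_def using Wc Uc Tc
        by (intro assoc_mult_mat[symmetric, of _ dim dim _ dim _ dim]) auto
      then show ?thesis using unitary_cancel(1)[OF T[OF h], of "W * U" dim] Wc Uc by simp
    qed
    have "(\<Sum>e\<in>?E. K' i' a (\<delta> div dB, e) * L' j b (\<delta> mod dB, e)) =
        (case i' of (h, i) \<Rightarrow> \<lambda>j. c h i j / sqrt dA) j * (W * U) $$ (a * dB + b, \<delta>)"
      if ab: "a < dA" "b < dB" and \<delta>: "\<delta> < dim" for a b \<delta>
    proof -
      note d = less_mult_div_mod[OF \<delta>]
      have row: "a * dB + b < dim" using ab by (rule mult_add_less_mult)
      have "(\<Sum>e\<in>?E. K' i' a (\<delta> div dB, e) * L' j b (\<delta> mod dB, e)) =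
          (\<Sum>t<dA. \<tau> h $$ (t, \<delta> div dB) / sqrt dA * M h i j a b (t * dB + \<delta> mod dB))"
        unfolding sum.cartesian_product' eq K'_def L'_def M_def prod.case sum_distrib_left
        by (intro sum.cong refl) simp
      also have "\<dots> = (\<Sum>t<dA. c h i j / sqrt dA * ((W * X h) $$ (a * dB + b, t * dB + \<delta> mod dB) *
          \<tau> h $$ (t, \<delta> div dB)))"
        using ab d by (intro sum.cong refl) (simp add: W(2) mult_add_less_mult del: index_mult_mat(1))
      also have "\<dots> = c h i j / sqrt dA * (\<Sum>t<dA. \<Sum>b'<dB. (W * X h) $$ (a * dB + b, t * dB + b') *
          T h $$ (t * dB + b', \<delta>))"
      proof -
        have "(\<Sum>b'<dB. (W * X h) $$ (a * dB + b, t * dB + b') * T h $$ (t * dB + b', \<delta>)) =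
            (W * X h) $$ (a * dB + b, t * dB + \<delta> mod dB) * \<tau> h $$ (t, \<delta> div dB)" if t: "t < dA" for t
        proof -
          have "(\<Sum>b'<dB. (W * X h) $$ (a * dB + b, t * dB + b') * T h $$ (t * dB + b', \<delta>)) =
              (\<Sum>b'<dB. if b' = \<delta> mod dB then (W * X h) $$ (a * dB + b, t * dB + b') * \<tau> h $$ (t, \<delta> div dB) else 0)"
            using \<tau>c t d \<delta> unfolding T_def
            by (intro sum.cong refl)
              (auto simp: kron_index mult_add_less_mult mult_add_div_mod simp del: index_mult_mat(1))
          then show ?thesis using d by simp
        qed
        then show ?thesis by (simp add: sum_distrib_left del: index_mult_mat(1))
      qed
      also have "(\<Sum>t<dA. \<Sum>b'<dB. (W * X h) $$ (a * dB + b, t * dB + b') * T h $$ (t * dB + b', \<delta>)) =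
          (\<Sum>i<dim. (W * X h) $$ (a * dB + b, i) * T h $$ (i, \<delta>))"
        by (simp only: sum_lessThan_mult)
      also have "\<dots> = (W * X h * T h) $$ (a * dB + b, \<delta>)"
        unfolding X_def
        using row \<delta> Wc Uc Tc by (intro mat_mult_index_sum[symmetric]) auto
      finally show ?thesis unfolding XT eq by simp
    qed
    then show "\<exists>W. local_unitary dA dB W \<and> (\<forall>a<dA. \<forall>b<dB. \<forall>\<delta><dim.
        (\<Sum>e\<in>?E. K' i' a (\<delta> div dB, e) * L' j b (\<delta> mod dB, e)) =
        (case i' of (h, i) \<Rightarrow> \<lambda>j. c h i j / sqrt dA) j * (W * U) $$ (a * dB + b, \<delta>))"
      using W(1) by blast
  next
    have "real (card ?E) * p = (\<Sum>h<dA\<^sup>2. real (card E) * p / dA)"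
      using dims_pos by (simp add: power2_eq_square card_cartesian_product)
    also have "\<dots> \<le> (\<Sum>h<dA\<^sup>2. (\<Sum>i\<in>I. \<Sum>j\<in>J. (cmod (c h i j))\<^sup>2) / dA)"
      using c unfolding P_def by (intro sum_mono divide_right_mono) auto
    also have "\<dots> = (\<Sum>i'\<in>?I. \<Sum>j\<in>J. (cmod ((case i' of (h, i) \<Rightarrow> \<lambda>j. c h i j / sqrt dA) j))\<^sup>2)"
      unfolding sum.cartesian_product' by (simp add: norm_divide power_divide sum_divide_distrib)
    finally show "real (card ?E) * p \<le>
        (\<Sum>i'\<in>?I. \<Sum>j\<in>J. (cmod ((case i' of (h, i) \<Rightarrow> \<lambda>j. c h i j / sqrt dA) j))\<^sup>2)" .
  qed
  ultimately have "protocol dA dB ?E ?I J K' L' U p"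
    unfolding protocol_def using fin by simp
  moreover have "card ?E = 2 ^ (nA + s)"
    by (simp add: card_cartesian_product s dims power_add)
  ultimately show ?thesis unfolding p_def by blast
qed

end

section \<open>States with coefficients in a Hilbert space\<close>

lemma scaleC_zero_left [simp]: "0 *\<^sub>C x = 0"
  using scaleC_of_real[of 0 x] by simp

lemma scaleC_zero_right [simp]: "c *\<^sub>C (0 :: 'e::complex_hilbert_space) = 0"
  using scaleC_add_right[of c 0 "0 :: 'e"] by simp

lemma scaleC_one [simp]: "1 *\<^sub>C x = x"
  using scaleC_of_real[of 1 x] by simp

lemma scaleC_sum_right: "c *\<^sub>C sum f A = (\<Sum>i\<in>A. c *\<^sub>C f i)"
  by (induction A rule: infinite_finite_induct) (auto simp: scaleC_add_right)

lemma scaleC_sum_left: "sum f A *\<^sub>C x = (\<Sum>i\<in>A. f i *\<^sub>C x)"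
  by (induction A rule: infinite_finite_induct) (auto simp: scaleC_add_left)

lemma cinner_scaleC_right: "cinner x (c *\<^sub>C y) = c * cinner x y"
  using cinner_commute[of x "c *\<^sub>C y"] cinner_commute[of x y] by (simp add: cinner_scaleC_left)

lemma cinner_sum_left: "cinner (sum f A) (y :: 'e::complex_hilbert_space) = (\<Sum>i\<in>A. cinner (f i) y)"
proof -
  have "cinner 0 y = 0" using cinner_add_left[of 0 0 y] by simp
  then show ?thesis
    by (induction A rule: infinite_finite_induct) (auto simp: cinner_add_left)
qed

lemma cinner_sum_right: "cinner y (sum f A) = (\<Sum>i\<in>A. cinner y (f i))"
  by (simp add: cinner_commute[of y] cinner_sum_left)

lemma norm_scaleC_power2: "(norm (c *\<^sub>C x))\<^sup>2 = (cmod c)\<^sup>2 * (norm x)\<^sup>2"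
proof -
  have "complex_of_real ((norm (c *\<^sub>C x))\<^sup>2) = complex_of_real ((cmod c)\<^sup>2 * (norm x)\<^sup>2)"
    unfolding of_real_mult complex_norm_square cinner_self[symmetric] cinner_scaleC_left cinner_scaleC_right
    by simp
  then show ?thesis by (simp only: of_real_eq_iff)
qed

text \<open>Expanding the norms through \<open>cinner\<close> avoids a basis of
  \<open>H\<^sub>E\<close>, which may be infinite-dimensional.\<close>

lemma sum_norm_isometry:
  fixes v :: "'c \<Rightarrow> 'e::complex_hilbert_space"
  assumes C: "finite C"
    and M: "\<And>k l. k \<in> C \<Longrightarrow> l \<in> C \<Longrightarrow> (\<Sum>i\<in>I. cnj (M i k) * M i l) = (if k = l then 1 else 0)"
  shows "(\<Sum>i\<in>I. (norm (\<Sum>k\<in>C. M i k *\<^sub>C v k))\<^sup>2) = (\<Sum>k\<in>C. (norm (v k))\<^sup>2)"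
proof -
  have "complex_of_real (\<Sum>i\<in>I. (norm (\<Sum>k\<in>C. M i k *\<^sub>C v k))\<^sup>2) =
      (\<Sum>i\<in>I. \<Sum>l\<in>C. \<Sum>k\<in>C. cnj (M i k) * M i l * cinner (v k) (v l))"
    unfolding of_real_sum cinner_self[symmetric] cinner_sum_left cinner_sum_right
      cinner_scaleC_left cinner_scaleC_right
    by (simp add: mult_ac sum_distrib_left)
  also have "\<dots> = (\<Sum>l\<in>C. \<Sum>k\<in>C. (\<Sum>i\<in>I. cnj (M i k) * M i l) * cinner (v k) (v l))"
    unfolding sum_distrib_right
    by (rule trans[OF sum.swap], rule sum.cong[OF refl], rule sum.swap)
  also have "\<dots> = (\<Sum>l\<in>C. \<Sum>k\<in>C. if k = l then cinner (v k) (v l) else 0)"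
    using M by (intro sum.cong refl) auto
  also have "\<dots> = complex_of_real (\<Sum>k\<in>C. (norm (v k))\<^sup>2)"
    using C by (simp add: cinner_self)
  finally show ?thesis by (simp only: of_real_eq_iff)
qed

text \<open>Stacked on top of each other, the Kraus operators form an isometry with rows
  \<open>(i, a)\<close>; this is the form that \<open>sum_norm_isometry\<close> takes.\<close>

lemma local_operation_sum:
  assumes "local_operation d d' Ks" "k < d" "l < d"
  shows "(\<Sum>(i, a)\<in>{..<length Ks} \<times> {..<d'}. cnj ((Ks ! i) $$ (a, k)) * (Ks ! i) $$ (a, l)) =
    (if k = l then 1 else 0)"
proof -
  have c: "Ks ! i \<in> carrier_mat d' d" if "i < length Ks" for i
    using assms(1) that unfolding local_operation_def by (meson nth_mem subsetD)
  have "(\<Sum>(i, a)\<in>{..<length Ks} \<times> {..<d'}. cnj ((Ks ! i) $$ (a, k)) * (Ks ! i) $$ (a, l)) =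
      (\<Sum>i<length Ks. (mat_adjoint (Ks ! i) * (Ks ! i)) $$ (k, l))"
    unfolding sum.cartesian_product[symmetric]
  proof (rule sum.cong[OF refl])
    fix i assume "i \<in> {..<length Ks}"
    then have "Ks ! i \<in> carrier_mat d' d" using c by simp
    then show "(\<Sum>a<d'. cnj ((Ks ! i) $$ (a, k)) * (Ks ! i) $$ (a, l)) =
        (mat_adjoint (Ks ! i) * (Ks ! i)) $$ (k, l)"
      using assms(2,3) by (subst mat_mult_index_sum[where n = d']) auto
  qed
  also have "\<dots> = (\<Sum>K\<leftarrow>Ks. (mat_adjoint K * K) $$ (k, l))"
    by (simp add: sum_list_sum_nth atLeast0LessThan del: index_mult_mat(1))
  also have "\<dots> = (if k = l then 1 else 0)"
    using assms unfolding local_operation_def by auto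
  finally show ?thesis .
qed

section \<open>Conservation of total probability\<close>

lemma norm_sq_apply_A:
  assumes "local_operation d d' Ks"
  shows "(\<Sum>i<length Ks. norm_sq d' n (apply_A (Ks ! i) \<chi>)) = norm_sq d n \<chi>"
proof -
  have c: "dim_col (Ks ! i) = d" if "i < length Ks" for i
    using assms that unfolding local_operation_def by (meson carrier_matD(2) nth_mem subsetD)
  have "(\<Sum>i<length Ks. norm_sq d' n (apply_A (Ks ! i) \<chi>)) =
      (\<Sum>i<length Ks. \<Sum>a<d'. \<Sum>b<n. (norm (\<Sum>k<d. (Ks ! i) $$ (a, k) *\<^sub>C \<chi> k b))\<^sup>2)"
    using c by (simp add: norm_sq_def apply_A_def)
  also have "\<dots> = (\<Sum>z\<in>{..<length Ks} \<times> {..<d'}. \<Sum>b<n.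
      (norm (\<Sum>k<d. (Ks ! fst z) $$ (snd z, k) *\<^sub>C \<chi> k b))\<^sup>2)"
    by (simp add: sum.cartesian_product')
  also have "\<dots> = (\<Sum>b<n. \<Sum>z\<in>{..<length Ks} \<times> {..<d'}.
      (norm (\<Sum>k<d. (Ks ! fst z) $$ (snd z, k) *\<^sub>C \<chi> k b))\<^sup>2)"
    by (rule sum.swap)
  also have "\<dots> = (\<Sum>b<n. \<Sum>k<d. (norm (\<chi> k b))\<^sup>2)"
    using local_operation_sum[OF assms]
    by (intro sum.cong refl sum_norm_isometry) (auto simp: case_prod_unfold)
  also have "\<dots> = norm_sq d n \<chi>" unfolding norm_sq_def by (rule sum.swap)
  finally show ?thesis .
qed

lemma norm_sq_apply_B:
  assumes "local_operation d d' Ks"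
  shows "(\<Sum>i<length Ks. norm_sq n d' (apply_B (Ks ! i) \<chi>)) = norm_sq n d \<chi>"
proof -
  have "norm_sq n q (apply_B K \<chi>) = norm_sq q n (apply_A K (\<lambda>b a. \<chi> a b))" for q K
    unfolding norm_sq_def apply_A_def apply_B_def by (rule sum.swap)
  moreover have "norm_sq n d \<chi> = norm_sq d n (\<lambda>b a. \<chi> a b)"
    unfolding norm_sq_def by (rule sum.swap)
  ultimately show ?thesis using norm_sq_apply_A[OF assms] by simp
qed

text \<open>Together, \<open>m\<close> EPR pairs are one maximally entangled pair of dimension
  \<open>2 ^ m\<close>: agreement of the \<open>m\<close> lowest bits is congruence. The induction
  removes the pair added last, which is the lowest bit.\<close>

lemma add_epr_funpow:
  "(add_epr ^^ m) \<psi> a b = (if a mod 2 ^ m = b mod 2 ^ m then complex_of_real (1 / sqrt (2 ^ m)) else 0) *\<^sub>C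
    \<psi> (a div 2 ^ m) (b div 2 ^ m)"
proof (induction m arbitrary: a b)
  case 0
  then show ?case by simp
next
  case (Suc m)
  have "a mod 2 ^ Suc m = b mod 2 ^ Suc m \<longleftrightarrow> a mod 2 = b mod 2 \<and> a div 2 mod 2 ^ m = b div 2 mod 2 ^ m"
  proof -
    have "2 * x + u = 2 * y + v \<longleftrightarrow> u = v \<and> x = y" if "u < 2" "v < 2" for u v x y :: nat
      using that by presburger
    then show ?thesis unfolding power_Suc mod_mult2_eq by simp
  qed
  moreover have "a div 2 div 2 ^ m = a div 2 ^ Suc m" for a :: nat
    by (simp add: div_mult2_eq)
  moreover have "(add_epr ^^ Suc m) \<psi> a b =
      epr (a mod 2) (b mod 2) *\<^sub>C (add_epr ^^ m) \<psi> (a div 2) (b div 2)"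
    by (simp add: add_epr_def[of "(add_epr ^^ m) \<psi>"])
  ultimately show ?case
    by (simp add: Suc epr_def scaleC_scaleC real_sqrt_mult)
qed

lemma norm_sq_add_epr:
  "norm_sq (dA * 2 ^ m) (dB * 2 ^ m) ((add_epr ^^ m) \<psi>) = norm_sq dA dB \<psi>"
proof -
  have "norm_sq (dA * 2 ^ m) (dB * 2 ^ m) ((add_epr ^^ m) \<psi>) =
      (\<Sum>a<dA. \<Sum>x<(2::nat) ^ m. \<Sum>b<dB. \<Sum>y<(2::nat) ^ m. if x = y then (norm (\<psi> a b))\<^sup>2 / 2 ^ m else 0)"
    unfolding norm_sq_def sum_lessThan_mult
    by (intro sum.cong refl)
      (simp add: add_epr_funpow mult_add_div_mod norm_scaleC_power2 norm_divide power_divide)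
  also have "\<dots> = (\<Sum>a<dA. \<Sum>x<(2::nat) ^ m. \<Sum>b<dB. (norm (\<psi> a b))\<^sup>2 / 2 ^ m)"
    by (intro sum.cong refl) simp
  also have "\<dots> = norm_sq dA dB \<psi>"
    unfolding norm_sq_def by (simp flip: sum_divide_distrib)
  finally show ?thesis .
qed

lemma outcomes_Sigma:
  "outcomes A B = (SIGMA i:{..<length (before A)}. SIGMA j:{..<length (before B)}.
     {..<length (after A i (msg B j))} \<times> {..<length (after B j (msg A i))})"
  by (auto simp: outcomes_def)

lemma finite_outcomes: "finite (outcomes A B)"
  unfolding outcomes_Sigma by (intro finite_SigmaI) auto

text \<open>The operations are summed from the last to the first, since the number of later outcomes
  depends on the earlier ones.\<close>

lemma sum_outcomes:
  assumes A: "valid_strategy nA m A" and B: "valid_strategy nB m B"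
  shows "(\<Sum>\<omega>\<in>outcomes A B. norm_sq (2 ^ nA) (2 ^ nB) (final_state m A B \<psi> \<omega>)) =
    norm_sq (2 ^ nA) (2 ^ nB) \<psi>"
proof -
  obtain d where d: "local_operation (2 ^ nA * 2 ^ m) d (before A)"
    "\<And>i y. i < length (before A) \<Longrightarrow> local_operation d (2 ^ nA) (after A i y)"
    using A unfolding valid_strategy_def by blast
  obtain d' where d': "local_operation (2 ^ nB * 2 ^ m) d' (before B)"
    "\<And>i y. i < length (before B) \<Longrightarrow> local_operation d' (2 ^ nB) (after B i y)"
    using B unfolding valid_strategy_def by blast
  define \<chi> where "\<chi> = (\<lambda>i j. apply_B (before B ! j) (apply_A (before A ! i) ((add_epr ^^ m) \<psi>)))"
  have "(\<Sum>\<omega>\<in>outcomes A B. norm_sq (2 ^ nA) (2 ^ nB) (final_state m A B \<psi> \<omega>)) =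
      (\<Sum>i<length (before A). \<Sum>j<length (before B). \<Sum>k<length (after A i (msg B j)).
        \<Sum>l<length (after B j (msg A i)). norm_sq (2 ^ nA) (2 ^ nB)
          (apply_B (after B j (msg A i) ! l) (apply_A (after A i (msg B j) ! k) (\<chi> i j))))"
    unfolding outcomes_Sigma final_state_def \<chi>_def
    by (simp add: sum.Sigma sum.cartesian_product case_prod_unfold)
  also have "\<dots> = (\<Sum>i<length (before A). \<Sum>j<length (before B). \<Sum>k<length (after A i (msg B j)).
      norm_sq (2 ^ nA) d' (apply_A (after A i (msg B j) ! k) (\<chi> i j)))"
    using d'(2) by (intro sum.cong refl norm_sq_apply_B) auto
  also have "\<dots> = (\<Sum>i<length (before A). \<Sum>j<length (before B). norm_sq d d' (\<chi> i j))"
    using d(2) by (intro sum.cong refl norm_sq_apply_A) auto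
  also have "\<dots> = (\<Sum>i<length (before A). norm_sq d (2 ^ nB * 2 ^ m) (apply_A (before A ! i) ((add_epr ^^ m) \<psi>)))"
    unfolding \<chi>_def using d'(1) by (intro sum.cong refl norm_sq_apply_B)
  also have "\<dots> = norm_sq (2 ^ nA * 2 ^ m) (2 ^ nB * 2 ^ m) ((add_epr ^^ m) \<psi>)"
    using d(1) by (rule norm_sq_apply_A)
  finally show ?thesis unfolding norm_sq_add_epr .
qed

section \<open>Joint operators on \<open>A\<close> and \<open>B\<close>\<close>

lemma apply_AB_cong:
  "(\<And>a b. a < dA \<Longrightarrow> b < dB \<Longrightarrow> \<chi> a b = \<chi>' a b) \<Longrightarrow> apply_AB dA dB U \<chi> = apply_AB dA dB U \<chi>'"
  unfolding apply_AB_def by (intro ext sum.cong refl) auto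

lemma apply_AB_scaleC: "apply_AB dA dB U (\<lambda>a b. c *\<^sub>C \<chi> a b) a b = c *\<^sub>C apply_AB dA dB U \<chi> a b"
  unfolding apply_AB_def by (simp add: scaleC_sum_right scaleC_scaleC mult.commute)

lemma apply_AB_mult:
  assumes "U \<in> carrier_mat (dA * dB) (dA * dB)" "V \<in> carrier_mat (dA * dB) (dA * dB)" "a < dA" "b < dB"
  shows "apply_AB dA dB (U * V) \<psi> a b = apply_AB dA dB U (apply_AB dA dB V \<psi>) a b"
proof -
  define f where "f = (\<lambda>i. \<psi> (i div dB) (i mod dB))"
  have row: "a * dB + b < dA * dB" using assms(3,4) by (rule mult_add_less_mult)
  have ap: "apply_AB dA dB W \<psi> a b = (\<Sum>j<dA * dB. W $$ (a * dB + b, j) *\<^sub>C f j)" for W a b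
    unfolding apply_AB_def sum_lessThan_mult f_def
    by (intro sum.cong refl) (simp add: mult_add_div_mod)
  have "apply_AB dA dB (U * V) \<psi> a b = (\<Sum>j<dA * dB. \<Sum>i<dA * dB. (U $$ (a * dB + b, i) * V $$ (i, j)) *\<^sub>C f j)"
    unfolding ap scaleC_sum_left[symmetric]
    using assms row by (intro sum.cong refl arg_cong2[where f = scaleC] mat_mult_index_sum) auto
  also have "\<dots> = (\<Sum>i<dA * dB. U $$ (a * dB + b, i) *\<^sub>C (\<Sum>j<dA * dB. V $$ (i, j) *\<^sub>C f j))"
    unfolding scaleC_sum_right scaleC_scaleC by (rule sum.swap)
  also have "\<dots> = (\<Sum>k<dA. \<Sum>l<dB. U $$ (a * dB + b, k * dB + l) *\<^sub>C apply_AB dA dB V \<psi> k l)"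
    unfolding ap by (simp only: sum_lessThan_mult)
  finally show ?thesis by (simp only: apply_AB_def[of dA dB U])
qed

lemma norm_sq_apply_AB:
  assumes "unitary_mat (dA * dB) U"
  shows "norm_sq dA dB (apply_AB dA dB U \<psi>) = norm_sq dA dB \<psi>"
proof -
  define f where "f = (\<lambda>i. \<psi> (i div dB) (i mod dB))"
  have "norm_sq dA dB (apply_AB dA dB U \<psi>) = (\<Sum>i<dA * dB. (norm (\<Sum>j<dA * dB. U $$ (i, j) *\<^sub>C f j))\<^sup>2)"
    unfolding norm_sq_def apply_AB_def sum_lessThan_mult f_def
    by (intro sum.cong refl arg_cong[where f = "\<lambda>x. (norm x)\<^sup>2"]) (simp add: mult_add_div_mod)
  also have "\<dots> = (\<Sum>j<dA * dB. (norm (f j))\<^sup>2)"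
    using unitary_columns[OF assms] by (intro sum_norm_isometry) auto
  also have "\<dots> = norm_sq dA dB \<psi>"
    unfolding norm_sq_def sum_lessThan_mult f_def by (intro sum.cong refl) (simp add: mult_add_div_mod)
  finally show ?thesis .
qed

lemma apply_AB_kron:
  assumes "\<alpha> \<in> carrier_mat dA dA" "\<beta> \<in> carrier_mat dB dB" "a < dA" "b < dB"
  shows "apply_B \<beta> (apply_A \<alpha> \<chi>) a b = apply_AB dA dB (kron \<alpha> \<beta>) \<chi> a b"
proof -
  have "apply_AB dA dB (kron \<alpha> \<beta>) \<chi> a b = (\<Sum>k<dA. \<Sum>l<dB. (\<alpha> $$ (a, k) * \<beta> $$ (b, l)) *\<^sub>C \<chi> k l)"
    unfolding apply_AB_def
    using assms kron_index_pair[of a \<alpha> _ b \<beta>] by (intro sum.cong refl) auto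
  also have "\<dots> = (\<Sum>l<dB. \<Sum>k<dA. (\<beta> $$ (b, l) * \<alpha> $$ (a, k)) *\<^sub>C \<chi> k l)"
    by (subst sum.swap) (simp only: mult.commute)
  also have "\<dots> = apply_B \<beta> (apply_A \<alpha> \<chi>) a b"
    using assms by (simp add: apply_A_def apply_B_def scaleC_sum_right scaleC_scaleC)
  finally show ?thesis by simp
qed

section \<open>Realization of the protocol\<close>

text \<open>Surplus EPR pairs are measured in the computational basis.\<close>

definition pad :: "('i \<Rightarrow> nat \<Rightarrow> nat \<times> 'e \<Rightarrow> complex) \<Rightarrow> 'i \<times> 'z \<Rightarrow> nat \<Rightarrow> nat \<times> 'e \<times> 'z \<Rightarrow> complex" where
  "pad K = (\<lambda>(i, z) r (c, e, z'). if z = z' then K i r (c, e) else 0)"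

lemma kraus_pad:
  assumes K: "kraus I R (C \<times> E) K" and Z: "finite Z"
  shows "kraus (I \<times> Z) R (C \<times> E \<times> Z) (pad K)"
  unfolding kraus_def
proof (intro ballI)
  fix v v' assume v: "v \<in> C \<times> E \<times> Z" "v' \<in> C \<times> E \<times> Z"
  obtain c e z c' e' z' where vs: "v = (c, e, z)" "v' = (c', e', z')" by (metis surj_pair)
  have z: "z \<in> Z" and m: "(c, e) \<in> C \<times> E" "(c', e') \<in> C \<times> E" using v vs by auto
  have "(\<Sum>i\<in>I \<times> Z. \<Sum>r\<in>R. cnj (pad K i r v) * pad K i r v') =
      (\<Sum>i\<in>I. \<Sum>y\<in>Z. if y = z then (if z = z' then \<Sum>r\<in>R. cnj (K i r (c, e)) * K i r (c', e') else 0) else 0)"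
    unfolding sum.cartesian_product' by (intro sum.cong refl) (auto simp: vs pad_def)
  also have "\<dots> = (if z = z' then \<Sum>i\<in>I. \<Sum>r\<in>R. cnj (K i r (c, e)) * K i r (c', e') else 0)"
    using z Z by simp
  also have "\<dots> = (if v = v' then 1 else 0)"
    unfolding krausD[OF K m] by (simp add: vs)
  finally show "(\<Sum>i\<in>I \<times> Z. \<Sum>r\<in>R. cnj (pad K i r v) * pad K i r v') = (if v = v' then 1 else 0)" .
qed

text \<open>The theorem demands every sufficiently large number of pairs, not just one. On surplus
  pairs both parties always see the same \<open>z\<close>, so the coefficients live on the diagonal
  and the weight grows by the cardinality of \<open>Z\<close>, as does the entangled basis.\<close>

lemma protocol_pad:
  assumes P: "protocol dA dB E (I :: 'i set) (J :: 'j set) K L U p" and Z: "finite (Z :: 'z set)"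
  shows "protocol dA dB (E \<times> Z) (I \<times> Z) (J \<times> Z) (pad K) (pad L) U p"
proof -
  have fin: "finite E" "finite I" "finite J" using P unfolding protocol_def by auto
  define M where "M i j a b \<delta> = (\<Sum>e\<in>E. K i a (\<delta> div dB, e) * L j b (\<delta> mod dB, e))" for i j a b \<delta>
  obtain c :: "'i \<Rightarrow> 'j \<Rightarrow> complex" where c: "\<And>i j. i \<in> I \<Longrightarrow> j \<in> J \<Longrightarrow> c i j \<noteq> 0 \<Longrightarrow> \<exists>W. local_unitary dA dB W \<and>
        (\<forall>a<dA. \<forall>b<dB. \<forall>\<delta><dA * dB. M i j a b \<delta> = c i j * (W * U) $$ (a * dB + b, \<delta>))"
      and w: "real (card E) * p \<le> (\<Sum>i\<in>I. \<Sum>j\<in>J. (cmod (c i j))\<^sup>2)"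
    using P unfolding protocol_def succeeds_def M_def by blast
  have sum: "(\<Sum>e\<in>E \<times> Z. pad K (i, z) a (\<delta> div dB, e) * pad L (j, z) b (\<delta> mod dB, e)) = M i j a b \<delta>"
    if "z \<in> Z" for i j z a b \<delta>
  proof -
    have "(\<Sum>e\<in>E \<times> Z. pad K (i, z) a (\<delta> div dB, e) * pad L (j, z) b (\<delta> mod dB, e)) =
        (\<Sum>e\<in>E. \<Sum>y\<in>Z. if z = y then K i a (\<delta> div dB, e) * L j b (\<delta> mod dB, e) else 0)"
      unfolding sum.cartesian_product' by (intro sum.cong refl) (auto simp: pad_def)
    then show ?thesis using that Z unfolding M_def by simp
  qed
  define C where "C = (\<lambda>(i, z :: 'z) (j, z'). if z = z' then c i j else 0)"
  have "succeeds dA dB (I \<times> Z) (J \<times> Z)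
      (\<lambda>i j a b \<delta>. \<Sum>e\<in>E \<times> Z. pad K i a (\<delta> div dB, e) * pad L j b (\<delta> mod dB, e)) U
      (real (card (E \<times> Z)) * p)"
    unfolding succeeds_def
  proof (intro exI[of _ C] conjI ballI impI)
    fix i' j' assume m: "i' \<in> I \<times> Z" "j' \<in> J \<times> Z" and nz: "C i' j' \<noteq> 0"
    then obtain i j z where eqs: "i' = (i, z)" "j' = (j, z)" and mem: "i \<in> I" "j \<in> J" "z \<in> Z"
      and cnz: "c i j \<noteq> 0" unfolding C_def by (auto split: if_splits)
    then have "C i' j' = c i j" by (simp add: C_def)
    then show "\<exists>W. local_unitary dA dB W \<and> (\<forall>a<dA. \<forall>b<dB. \<forall>\<delta><dA * dB.
        (\<Sum>e\<in>E \<times> Z. pad K i' a (\<delta> div dB, e) * pad L j' b (\<delta> mod dB, e)) =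
          C i' j' * (W * U) $$ (a * dB + b, \<delta>))"
      unfolding eqs sum[OF mem(3)] using c[OF mem(1,2) cnz] by simp
  next
    have "real (card (E \<times> Z)) * p = (\<Sum>z\<in>Z. real (card E) * p)"
      by (simp add: card_cartesian_product)
    also have "\<dots> \<le> (\<Sum>z\<in>Z. \<Sum>i\<in>I. \<Sum>j\<in>J. (cmod (c i j))\<^sup>2)"
      using w by (intro sum_mono)
    also have "\<dots> = (\<Sum>i\<in>I. \<Sum>z\<in>Z. \<Sum>j\<in>J. \<Sum>z'\<in>Z. if z = z' then (cmod (c i j))\<^sup>2 else 0)"
      using Z by (subst sum.swap) simp
    also have "\<dots> = (\<Sum>i\<in>I \<times> Z. \<Sum>j\<in>J \<times> Z. (cmod (C i j))\<^sup>2)"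
      unfolding sum.cartesian_product' by (intro sum.cong refl) (auto simp: C_def)
    finally show "real (card (E \<times> Z)) * p \<le> (\<Sum>i\<in>I \<times> Z. \<Sum>j\<in>J \<times> Z. (cmod (C i j))\<^sup>2)" .
  qed
  then show ?thesis
    using P Z fin unfolding protocol_def by (auto intro!: kraus_pad)
qed

lemma protocol_nat:
  assumes P: "protocol dA dB E I J K L U p"
  shows "\<exists>K' L'. protocol dA dB {..<card E} {..<card I} {..<card J} K' L' U p"
proof -
  have fin: "finite E" "finite I" "finite J" using P unfolding protocol_def by auto
  obtain e f g where bij: "bij_betw e {..<card E} E" "bij_betw f {..<card I} I" "bij_betw g {..<card J} J"
    using fin ex_bij_betw_nat_finite by (metis atLeast0LessThan)
  have pair: "bij_betw (\<lambda>(c, z). (c, e z)) ({..<d} \<times> {..<card E}) ({..<d} \<times> E)" for d :: nat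
    using bij(1) unfolding bij_betw_def inj_on_def by (auto simp: image_iff) blast
  define K' where "K' = (\<lambda>i a z. K (f i) a (case z of (c, z) \<Rightarrow> (c, e z)))"
  define L' where "L' = (\<lambda>j b z. L (g j) b (case z of (c, z) \<Rightarrow> (c, e z)))"
  have "kraus {..<card I} {..<dA} ({..<dA} \<times> {..<card E}) K'"
    unfolding K'_def using P by (intro kraus_reindex[OF _ bij(2) pair]) (simp add: protocol_def)
  moreover have "kraus {..<card J} {..<dB} ({..<dB} \<times> {..<card E}) L'"
    unfolding L'_def using P by (intro kraus_reindex[OF _ bij(3) pair]) (simp add: protocol_def)
  moreover have "succeeds dA dB {..<card I} {..<card J}
      (\<lambda>i j a b \<delta>. \<Sum>z<card E. K' i a (\<delta> div dB, z) * L' j b (\<delta> mod dB, z)) U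
      (real (card {..<card E}) * p)"
    unfolding card_lessThan
  proof (rule succeeds_reindex[OF _ bij(2,3)])
    show "succeeds dA dB I J (\<lambda>i j a b \<delta>. \<Sum>e\<in>E. K i a (\<delta> div dB, e) * L j b (\<delta> mod dB, e)) U
        (real (card E) * p)"
      using P unfolding protocol_def by blast
    show "(\<Sum>z<card E. K' i a (\<delta> div dB, z) * L' j b (\<delta> mod dB, z)) =
        (\<Sum>e\<in>E. K (f i) a (\<delta> div dB, e) * L (g j) b (\<delta> mod dB, e))" for i j a b \<delta>
      unfolding K'_def L'_def prod.case by (rule sum.reindex_bij_betw[OF bij(1)])
  qed
  ultimately show ?thesis unfolding protocol_def by auto
qed

text \<open>The index of the EPR halves is the low-order part of the column number, matching
  \<open>add_epr\<close>.\<close>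

definition kraus_mat :: "nat \<Rightarrow> nat \<Rightarrow> (nat \<Rightarrow> nat \<times> nat \<Rightarrow> complex) \<Rightarrow> complex mat" where
  "kraus_mat d M F = mat d (d * M) (\<lambda>(r, c). F r (c div M, c mod M))"

lemma local_operation_kraus_mat:
  assumes K: "kraus {..<n} {..<d} ({..<d} \<times> {..<M}) K"
  shows "local_operation (d * M) d (map (\<lambda>i. kraus_mat d M (K i)) [0..<n])"
  unfolding local_operation_def
proof (intro conjI allI impI)
  fix i j assume ij: "i < d * M" "j < d * M"
  note m = less_mult_div_mod[OF ij(1)] less_mult_div_mod[OF ij(2)]
  have "(\<Sum>K\<leftarrow>map (\<lambda>i. kraus_mat d M (K i)) [0..<n]. (mat_adjoint K * K) $$ (i, j)) =
      (\<Sum>k<n. (mat_adjoint (kraus_mat d M (K k)) * kraus_mat d M (K k)) $$ (i, j))"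
    by (simp add: interv_sum_list_conv_sum_set_nat atLeast0LessThan comp_def del: index_mult_mat(1))
  also have "\<dots> = (\<Sum>k<n. \<Sum>r<d. cnj (K k r (i div M, i mod M)) * K k r (j div M, j mod M))"
    using ij by (intro sum.cong refl, subst mat_mult_index_sum[where n = d]) (auto simp: kraus_mat_def)
  also have "\<dots> = (if (i div M, i mod M) = (j div M, j mod M) then 1 else 0)"
    using m by (intro krausD[OF K]) auto
  also have "\<dots> = 1\<^sub>m (d * M) $$ (i, j)"
    using ij by (simp) (metis div_mult_mod_eq)
  finally show "(\<Sum>K\<leftarrow>map (\<lambda>i. kraus_mat d M (K i)) [0..<n]. (mat_adjoint K * K) $$ (i, j)) =
      1\<^sub>m (d * M) $$ (i, j)" .
qed (auto simp: kraus_mat_def)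

lemma local_operation_unitary:
  "unitary_mat d U \<Longrightarrow> local_operation d d [U]"
  by (auto simp: local_operation_def unitary_mat_def)

text \<open>The entangled state identifies the two indices of the EPR halves, which contracts the
  Kraus operators over \<open>e\<close>. The prefactor is the normalization left out in
  \<open>protocol\<close>.\<close>

lemma apply_kraus_mats:
  fixes \<psi> :: "'e::complex_hilbert_space state"
  assumes "a < dA" "b < dB"
  shows "apply_B (kraus_mat dB (2 ^ m) G) (apply_A (kraus_mat dA (2 ^ m) F) ((add_epr ^^ m) \<psi>)) a b =
    complex_of_real (1 / sqrt (2 ^ m)) *\<^sub>C (\<Sum>k<dA. \<Sum>l<dB. (\<Sum>e<2 ^ m. F a (k, e) * G b (l, e)) *\<^sub>C \<psi> k l)"
proof -
  let ?M = "2 ^ m :: nat" and ?s = "complex_of_real (1 / sqrt (2 ^ m))"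
  have "apply_B (kraus_mat dB ?M G) (apply_A (kraus_mat dA ?M F) ((add_epr ^^ m) \<psi>)) a b =
      (\<Sum>l<dB. \<Sum>e<?M. G b (l, e) *\<^sub>C (\<Sum>k<dA. \<Sum>e'<?M. F a (k, e') *\<^sub>C
        (if e' = e then ?s else 0) *\<^sub>C \<psi> k l))"
    unfolding apply_B_def apply_A_def kraus_mat_def dim_col_mat sum_lessThan_mult
    using assms by (intro sum.cong refl arg_cong2[where f = scaleC])
      (simp_all add: mult_add_less_mult mult_add_div_mod add_epr_funpow)
  also have "\<dots> = (\<Sum>l<dB. \<Sum>e<?M. G b (l, e) *\<^sub>C (\<Sum>k<dA. (F a (k, e) * ?s) *\<^sub>C \<psi> k l))"
  proof -
    have "(\<Sum>e'<?M. F a (k, e') *\<^sub>C (if e' = e then ?s else 0) *\<^sub>C \<psi> k l) = (F a (k, e) * ?s) *\<^sub>C \<psi> k l"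
      if "e < ?M" for k l e
    proof -
      have "(\<Sum>e'<?M. F a (k, e') *\<^sub>C (if e' = e then ?s else 0) *\<^sub>C \<psi> k l) =
          (\<Sum>e'<?M. if e' = e then (F a (k, e) * ?s) *\<^sub>C \<psi> k l else 0)"
        by (intro sum.cong refl) (auto simp: scaleC_scaleC)
      then show ?thesis using that by simp
    qed
    then show ?thesis by (intro sum.cong refl arg_cong2[where f = scaleC]) auto
  qed
  also have "\<dots> = (\<Sum>l<dB. \<Sum>k<dA. \<Sum>e<?M. (?s * (F a (k, e) * G b (l, e))) *\<^sub>C \<psi> k l)"
    unfolding scaleC_sum_right scaleC_scaleC
    by (rule sum.cong[OF refl], rule trans[OF sum.swap]) (simp only: mult_ac)
  also have "\<dots> = ?s *\<^sub>C (\<Sum>k<dA. \<Sum>l<dB. (\<Sum>e<?M. F a (k, e) * G b (l, e)) *\<^sub>C \<psi> k l)"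
    unfolding scaleC_sum_right scaleC_scaleC scaleC_sum_left sum_distrib_left by (rule sum.swap)
  finally show ?thesis .
qed

text \<open>Unsuccessful outcomes need no analysis: all probabilities add up to 1, so it is enough
  that the outcomes with nonzero scalar, where the local unitary can be undone exactly, have weight
  at least \<open>1 - \<epsilon>\<close>.\<close>

lemma protocol_realisation:
  fixes K L :: "nat \<Rightarrow> nat \<Rightarrow> nat \<times> nat \<Rightarrow> complex"
  assumes P: "protocol (2 ^ nA) (2 ^ nB) {..<2 ^ m} {..<nI} {..<nJ} K L U (1 - \<epsilon>)"
    and U: "unitary_mat (2 ^ nA * 2 ^ nB) U"
  shows "\<exists>A B. valid_strategy nA m A \<and> valid_strategy nB m B \<and>
    (\<forall>\<psi> :: 'e::complex_hilbert_space state. norm_sq (2 ^ nA) (2 ^ nB) \<psi> = 1 \<longrightarrow>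
      failure_prob nA nB m A B \<psi> (apply_AB (2 ^ nA) (2 ^ nB) U \<psi>) \<le> \<epsilon>)"
proof -
  define dA dB :: nat where d: "dA = 2 ^ nA" "dB = 2 ^ nB"
  define M where "M i j a b \<delta> = (\<Sum>e<2 ^ m. K i a (\<delta> div dB, e) * L j b (\<delta> mod dB, e))" for i j a b \<delta>
  have PK: "kraus {..<nI} {..<dA} ({..<dA} \<times> {..<2 ^ m}) K"
    and PL: "kraus {..<nJ} {..<dB} ({..<dB} \<times> {..<2 ^ m}) L"
    using P unfolding protocol_def d by auto
  have Uc: "U \<in> carrier_mat (dA * dB) (dA * dB)" using U unitary_carrier unfolding d by blast
  obtain c where c: "\<And>i j. i < nI \<Longrightarrow> j < nJ \<Longrightarrow> c i j \<noteq> 0 \<Longrightarrow> \<exists>W. local_unitary dA dB W \<and>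
        (\<forall>a<dA. \<forall>b<dB. \<forall>\<delta><dA * dB. M i j a b \<delta> = c i j * (W * U) $$ (a * dB + b, \<delta>))"
      and w: "2 ^ m * (1 - \<epsilon>) \<le> (\<Sum>i<nI. \<Sum>j<nJ. (cmod (c i j))\<^sup>2)"
    using P unfolding protocol_def succeeds_def d M_def by auto
  define good where "good i j \<longleftrightarrow> i < nI \<and> j < nJ \<and> c i j \<noteq> 0" for i j
  \<comment> \<open>A valid strategy needs an operation for every outcome and every message, so
    identities are supplied wherever \<open>good\<close> fails.\<close>
  have "\<exists>\<alpha> \<beta>. unitary_mat dA \<alpha> \<and> unitary_mat dB \<beta> \<and> (good i j \<longrightarrow> (\<forall>a<dA. \<forall>b<dB. \<forall>\<delta><dA * dB.
      M i j a b \<delta> = c i j * (kron \<alpha> \<beta> * U) $$ (a * dB + b, \<delta>)))" for i j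
  proof (cases "good i j")
    case True
    then obtain W where W: "local_unitary dA dB W"
      "\<forall>a<dA. \<forall>b<dB. \<forall>\<delta><dA * dB. M i j a b \<delta> = c i j * (W * U) $$ (a * dB + b, \<delta>)"
      using c[of i j] unfolding good_def by blast
    then show ?thesis unfolding local_unitary_def by blast
  qed (use unitary_one in blast)
  then obtain \<alpha> \<beta> where \<alpha>: "\<And>i j. unitary_mat dA (\<alpha> i j)" and \<beta>: "\<And>i j. unitary_mat dB (\<beta> i j)"
    and M: "\<And>i j a b \<delta>. good i j \<Longrightarrow> a < dA \<Longrightarrow> b < dB \<Longrightarrow> \<delta> < dA * dB \<Longrightarrow>
      M i j a b \<delta> = c i j * (kron (\<alpha> i j) (\<beta> i j) * U) $$ (a * dB + b, \<delta>)"
    by metis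
  \<comment> \<open>The first operation already ends in dimension \<open>dA\<close>. After the
    exchange both parties know \<open>(i, j)\<close>, and each undoes its own factor of the local
    unitary.\<close>
  define A where "A = \<lparr>before = map (\<lambda>i. kraus_mat dA (2 ^ m) (K i)) [0..<nI], msg = (\<lambda>i. i),
    after = (\<lambda>i j. [mat_adjoint (\<alpha> i j)])\<rparr>"
  define B where "B = \<lparr>before = map (\<lambda>j. kraus_mat dB (2 ^ m) (L j)) [0..<nJ], msg = (\<lambda>j. j),
    after = (\<lambda>j i. [mat_adjoint (\<beta> i j)])\<rparr>"
  have vA: "valid_strategy nA m A"
    unfolding valid_strategy_def A_def d[symmetric]
    using local_operation_kraus_mat[OF PK] local_operation_unitary[OF unitary_adjoint[OF \<alpha>]]
    by (intro exI[of _ dA]) auto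
  have vB: "valid_strategy nB m B"
    unfolding valid_strategy_def B_def d[symmetric]
    using local_operation_kraus_mat[OF PL] local_operation_unitary[OF unitary_adjoint[OF \<beta>]]
    by (intro exI[of _ dB]) auto
  have "failure_prob nA nB m A B \<psi> (apply_AB dA dB U \<psi>) \<le> \<epsilon>"
    if \<psi>: "norm_sq dA dB \<psi> = 1" for \<psi> :: "'e state"
  proof -
    let ?\<phi> = "apply_AB dA dB U \<psi>"
    let ?p = "\<lambda>\<omega>. norm_sq dA dB (final_state m A B \<psi> \<omega>)"
    define s where "s = complex_of_real (1 / sqrt (2 ^ m))"
    have final: "final_state m A B \<psi> (i, j, 0, 0) a b = (s * c i j) *\<^sub>C ?\<phi> a b"
      if g: "good i j" and ab: "a < dA" "b < dB" for i j a b
    proof -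
      define W where "W = kron (\<alpha> i j) (\<beta> i j)"
      have ij: "i < nI" "j < nJ" using g unfolding good_def by auto
      have Wu: "unitary_mat (dA * dB) W" unfolding W_def by (intro unitary_kron \<alpha> \<beta>)
      have Wc: "W \<in> carrier_mat (dA * dB) (dA * dB)" "mat_adjoint W \<in> carrier_mat (dA * dB) (dA * dB)"
        using unitary_carrier[OF Wu] unitary_carrier[OF unitary_adjoint[OF Wu]] .
      define \<chi> where "\<chi> = apply_B (kraus_mat dB (2 ^ m) (L j))
        (apply_A (kraus_mat dA (2 ^ m) (K i)) ((add_epr ^^ m) \<psi>))"
      have \<chi>: "\<chi> a b = (s * c i j) *\<^sub>C apply_AB dA dB (W * U) \<psi> a b" if ab: "a < dA" "b < dB" for a b
      proof -
        have "\<chi> a b = s *\<^sub>C (\<Sum>k<dA. \<Sum>l<dB. M i j a b (k * dB + l) *\<^sub>C \<psi> k l)"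
          unfolding \<chi>_def apply_kraus_mats[OF ab] s_def M_def
          by (intro arg_cong2[where f = scaleC] sum.cong refl) (simp add: mult_add_div_mod)
        also have "(\<Sum>k<dA. \<Sum>l<dB. M i j a b (k * dB + l) *\<^sub>C \<psi> k l) =
            (\<Sum>k<dA. \<Sum>l<dB. (c i j * (W * U) $$ (a * dB + b, k * dB + l)) *\<^sub>C \<psi> k l)"
          using M[OF g ab] unfolding W_def
          by (intro sum.cong refl arg_cong2[where f = scaleC]) (auto simp: mult_add_less_mult)
        also have "\<dots> = c i j *\<^sub>C apply_AB dA dB (W * U) \<psi> a b"
          unfolding apply_AB_def scaleC_sum_right scaleC_scaleC ..
        finally show ?thesis by (simp only: scaleC_scaleC)
      qed
      have "final_state m A B \<psi> (i, j, 0, 0) a b =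
          apply_B (mat_adjoint (\<beta> i j)) (apply_A (mat_adjoint (\<alpha> i j)) \<chi>) a b"
        using ij by (simp add: final_state_def A_def B_def \<chi>_def)
      also have "\<dots> = apply_AB dA dB (mat_adjoint W) \<chi> a b"
        unfolding W_def kron_adjoint
        by (intro apply_AB_kron ab unitary_carrier unitary_adjoint \<alpha> \<beta>)
      also have "\<dots> = apply_AB dA dB (mat_adjoint W) (\<lambda>a b. (s * c i j) *\<^sub>C apply_AB dA dB (W * U) \<psi> a b) a b"
        using \<chi> by (simp cong: apply_AB_cong)
      also have "\<dots> = (s * c i j) *\<^sub>C apply_AB dA dB (mat_adjoint W * (W * U)) \<psi> a b"
        unfolding apply_AB_scaleC using Wc Uc ab by (subst apply_AB_mult) auto
      also have "mat_adjoint W * (W * U) = U"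
      proof -
        have "mat_adjoint W * (W * U) = (mat_adjoint W * W) * U"
          using Wc Uc by (intro assoc_mult_mat[symmetric])
        then show ?thesis using Wu Uc by (simp add: unitary_mat_def)
      qed
      finally show ?thesis .
    qed
    define good_outcomes where "good_outcomes = (\<lambda>(i, j). (i, j, 0 :: nat, 0 :: nat)) ` {(i, j). good i j}"
    have sub: "good_outcomes \<subseteq> {\<omega> \<in> outcomes A B. same_state dA dB (final_state m A B \<psi> \<omega>) ?\<phi>}"
    proof
      fix \<omega> assume "\<omega> \<in> good_outcomes"
      then obtain i j where \<omega>: "\<omega> = (i, j, 0, 0)" and g: "good i j" unfolding good_outcomes_def by auto
      have "\<omega> \<in> outcomes A B" using g unfolding \<omega> good_def outcomes_def A_def B_def by simp
      moreover have "same_state dA dB (final_state m A B \<psi> \<omega>) ?\<phi>"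
        unfolding same_state_def \<omega> using final[OF g] by blast
      ultimately show "\<omega> \<in> {\<omega> \<in> outcomes A B. same_state dA dB (final_state m A B \<psi> \<omega>) ?\<phi>}" by blast
    qed
    \<comment> \<open>Unitarity of \<open>U\<close> gives the target norm 1, so this probability is
      the same for every initial state.\<close>
    have p_good: "?p (i, j, 0, 0) = (cmod (c i j))\<^sup>2 / 2 ^ m" if g: "good i j" for i j
    proof -
      have "?p (i, j, 0, 0) = (cmod (s * c i j))\<^sup>2 * norm_sq dA dB ?\<phi>"
        unfolding norm_sq_def sum_distrib_left
        by (intro sum.cong refl) (simp add: final[OF g] norm_scaleC_power2)
      also have "norm_sq dA dB ?\<phi> = 1" using norm_sq_apply_AB U \<psi> unfolding d by metis
      finally show ?thesis by (simp add: s_def norm_mult norm_divide power_mult_distrib power_divide)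
    qed
    have "1 - \<epsilon> \<le> (\<Sum>i<nI. \<Sum>j<nJ. (cmod (c i j))\<^sup>2) / 2 ^ m"
      using w by (simp add: pos_le_divide_eq mult.commute)
    also have "\<dots> = (\<Sum>(i, j)\<in>{..<nI} \<times> {..<nJ}. (cmod (c i j))\<^sup>2 / 2 ^ m)"
      by (simp add: sum.cartesian_product sum_divide_distrib case_prod_unfold)
    also have "\<dots> = (\<Sum>(i, j)\<in>{(i, j). good i j}. (cmod (c i j))\<^sup>2 / 2 ^ m)"
      by (rule sum.mono_neutral_right) (auto simp: good_def)
    also have "\<dots> = (\<Sum>\<omega>\<in>good_outcomes. ?p \<omega>)"
      unfolding good_outcomes_def
      by (subst sum.reindex) (auto simp: inj_on_def p_good intro!: sum.cong)
    \<comment> \<open>Possibly strict, as an outcome that is not \<open>good\<close> may still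
      produce the right state.\<close>
    also have "\<dots> \<le> (\<Sum>\<omega>\<in>{\<omega> \<in> outcomes A B. same_state dA dB (final_state m A B \<psi> \<omega>) ?\<phi>}. ?p \<omega>)"
      using sub finite_outcomes by (intro sum_mono2) (auto simp: norm_sq_def intro!: sum_nonneg)
    also have "\<dots> = (\<Sum>\<omega>\<in>outcomes A B. ?p \<omega>) - failure_prob nA nB m A B \<psi> ?\<phi>"
    proof -
      let ?S = "\<lambda>\<omega>. same_state dA dB (final_state m A B \<psi> \<omega>) ?\<phi>"
      have "(\<Sum>\<omega>\<in>outcomes A B. ?p \<omega>) =
          (\<Sum>\<omega>\<in>{\<omega> \<in> outcomes A B. ?S \<omega>} \<union> {\<omega> \<in> outcomes A B. \<not> ?S \<omega>}. ?p \<omega>)"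
        by (intro sum.cong) auto
      also have "\<dots> = (\<Sum>\<omega>\<in>{\<omega> \<in> outcomes A B. ?S \<omega>}. ?p \<omega>) + (\<Sum>\<omega>\<in>{\<omega> \<in> outcomes A B. \<not> ?S \<omega>}. ?p \<omega>)"
        using finite_outcomes by (intro sum.union_disjoint) auto
      finally show ?thesis unfolding failure_prob_def d by simp
    qed
    also have "(\<Sum>\<omega>\<in>outcomes A B. ?p \<omega>) = 1"
      using sum_outcomes[OF vA vB, of \<psi>] \<psi> unfolding d by simp
    finally show ?thesis by simp
  qed
  then show ?thesis using vA vB unfolding d by blast
qed

theorem corollary4p2:
  fixes nA nB :: nat and U :: "complex mat" and \<epsilon> :: real
  assumes "unitary_mat (2 ^ nA * 2 ^ nB) U"
    and "\<epsilon> > 0"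
  shows "\<exists>m0. \<forall>m\<ge>m0. \<exists>A B.
    valid_strategy nA m A \<and> valid_strategy nB m B \<and>
    (\<forall>\<psi> :: 'e::complex_hilbert_space state.
      norm_sq (2 ^ nA) (2 ^ nB) \<psi> = 1 \<longrightarrow>
      failure_prob nA nB m A B \<psi> (apply_AB (2 ^ nA) (2 ^ nB) U \<psi>) \<le> \<epsilon>)"
proof -
  define dA dB :: nat where d: "dA = 2 ^ nA" "dB = 2 ^ nB"
  have pos: "dA > 0" "dB > 0" by (simp_all add: d)
  obtain \<tau> where \<tau>: "error_basis dA \<tau>" using error_basis_exists[OF pos(1)] .
  obtain \<rho> where \<rho>: "error_basis dB \<rho>" using error_basis_exists[OF pos(2)] .
  define \<sigma> where "\<sigma> q = kron (\<tau> (q div dB\<^sup>2)) (\<rho> (q mod dB\<^sup>2))" for q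
  interpret error_bases nA nB dA dB \<tau> \<sigma>
  proof
    show "error_basis (dA * dB) \<sigma>" unfolding \<sigma>_def using \<tau> \<rho> by (rule error_basis_kron)
    fix q assume "q < (dA * dB)\<^sup>2"
    then have "q < dA\<^sup>2 * dB\<^sup>2" by (simp add: power_mult_distrib)
    then show "local_unitary dA dB (\<sigma> q)"
      unfolding \<sigma>_def local_unitary_def
      using error_basis_unitary[OF \<tau>] error_basis_unitary[OF \<rho>] less_mult_div_mod by blast
  qed (fact d \<tau>)+
  obtain n where n: "(1 - 1 / (real (dA * dB))\<^sup>2) ^ n < \<epsilon>"
    using real_arch_pow_inv[OF assms(2) failure_rate(2)] by blast
  obtain E I :: "(nat \<times> nat) set" and J :: "nat set" and K L s where s: "card E = 2 ^ s"
    and P: "protocol dA dB E I J K L U (1 - (1 - 1 / (real (dA * dB))\<^sup>2) ^ n)"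
    using protocol_exists[of U n] assms(1) unfolding d by blast
  show ?thesis
  \<comment> \<open>The protocol consumes \<open>s\<close> pairs; the other \<open>m - s\<close> are
    left to \<open>protocol_pad\<close>.\<close>
  proof (intro exI[of _ s] allI impI)
    fix m assume "m \<ge> s"
    define Z where "Z = {..<(2::nat) ^ (m - s)}"
    have "protocol dA dB E I J K L U (1 - \<epsilon>)"
      using P n unfolding protocol_def by (auto elim!: succeeds_mono intro!: mult_left_mono)
    then have "protocol dA dB (E \<times> Z) (I \<times> Z) (J \<times> Z) (pad K) (pad L) U (1 - \<epsilon>)"
      by (rule protocol_pad) (simp add: Z_def)
    moreover have "card (E \<times> Z) = 2 ^ m"
      using \<open>m \<ge> s\<close> by (simp add: card_cartesian_product s Z_def flip: power_add)
    ultimately obtain K' L' where "protocol dA dB {..<(2::nat) ^ m} {..<card (I \<times> Z)} {..<card (J \<times> Z)} K' L' U (1 - \<epsilon>)"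
      using protocol_nat by metis
    then show "\<exists>A B. valid_strategy nA m A \<and> valid_strategy nB m B \<and>
      (\<forall>\<psi> :: 'e state. norm_sq (2 ^ nA) (2 ^ nB) \<psi> = 1 \<longrightarrow>
        failure_prob nA nB m A B \<psi> (apply_AB (2 ^ nA) (2 ^ nB) U \<psi>) \<le> \<epsilon>)"
      unfolding d using assms(1) by (rule protocol_realisation)
  qed
qed

end
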